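(* Let $\sigma:\Sigma\to\Sigma$ be a transitive one-sided subshift of finite type and let $A\in C^\theta(\hat\Sigma)$ be a $\theta$-Hölder potential. Then, for each $\mathbf x\in\Omega(A)$, the function $S_A(\mathbf x,\cdot)$ is a $\theta$-Hölder (real-valued) calibrated sub-action for $A$.
   Context: Let $\mathbf M$ be an $r\times r$ matrix with entries in $\{0,1\}$. The one-sided subshift of finite type is $\Sigma=\{\mathbf x=(x_0,x_1,\ldots)\in\{1,\ldots,r\}^{\mathbb N}:\mathbf M(x_j,x_{j+1})=1\ \forall j\ge 0\}$ (nonempty), with the left shift $\sigma(x_0,x_1,\ldots)=(x_1,x_2,\ldots)$. Fix $\lambda\in(0,1)$; $\Sigma$ has the metric $d(\mathbf x,\bar{\mathbf x})=\lambda^{k}$, $k=\min\{j:x_j\ne\bar x_j\}$ (and $d(\mathbf x,\mathbf x)=0$). The dual space is $\Sigma^*=\{\mathbf y=(\ldots,y_1,y_0)\in\{1,\ldots,r\}^{\mathbb N}:\mathbf M(y_{j+1},y_j)=1\ \forall j\ge0\}$, with the analogous metric. Let $\hat\Sigma=\{(\mathbf y,\mathbf x)\in\Sigma^*\times\Sigma:\mathbf M(y_0,x_0)=1\}$, with the maximum metric induced from the product. Define $\tau:\hat\Sigma\to\Sigma$ by $\tau(\mathbf y,\mathbf x)=\tau_{\mathbf y}(\mathbf x)=(y_0,x_0,x_1,\ldots)$, and for $\mathbf x\in\Sigma$ let $\Sigma^*_{\mathbf x}=\{\mathbf y\in\Sigma^*:(\mathbf y,\mathbf x)\in\hat\Sigma\}$.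 $C^0(\cdot)$ denotes real-valued continuous functions and $C^\theta(\cdot)$ (with $\theta>0$) the $\theta$-Hölder ones. Transitive means topologically transitive: for all nonempty open $D,E\subset\Sigma$ there is $k\ge1$ with $\sigma^k(D)\cap E\neq\emptyset$. The set $\mathcal M_0$ of holonomic probabilities is the set of Borel probability measures $\hat\mu$ on $\hat\Sigma$ such that $\int f(\tau_{\mathbf y}(\mathbf x))\,d\hat\mu(\mathbf y,\mathbf x)=\int f(\mathbf x)\,d\hat\mu(\mathbf y,\mathbf x)$ for all $f\in C^0(\Sigma)$. For $A\in C^0(\hat\Sigma)$, $\beta_A=\max_{\hat\mu\in\mathcal M_0}\int_{\hat\Sigma}A\,d\hat\mu$. A calibrated sub-action for $A$ is $u\in C^0(\Sigma)$ with $u(\mathbf x)=\min_{\mathbf y\in\Sigma^*_{\mathbf x}}[u(\tau_{\mathbf y}(\mathbf x))-A(\mathbf y,\mathbf x)+\beta_A]$ for all $\mathbf x\in\Sigma$. For $\epsilon>0$ and $\mathbf x,\bar{\mathbf x}\in\Sigma$, $\mathcal P(\mathbf x,\bar{\mathbf x},\epsilon)$ is the set of finite sequences (paths) $(\mathbf y^0,\mathbf x^0),\ldots,(\mathbf y^{k-1},\mathbf x^{k-1})\in\hat\Sigma$, $k\ge1$, with $\mathbf x^0=\bar{\mathbf x}$, $\mathbf x^{j+1}=\tau_{\mathbf y^j}(\mathbf x^j)$ for $0\le j<k-1$, and $d(\tau_{\mathbf y^{k-1}}(\mathbf x^{k-1}),\mathbf x)<\epsilon$. The set of non-wandering points $\Omega(A)$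 consists of those $\mathbf x\in\Sigma$ such that for every $\epsilon>0$ there is a path in $\mathcal P(\mathbf x,\mathbf x,\epsilon)$ with $|\sum_{j=0}^{k-1}(A-\beta_A)(\mathbf y^j,\mathbf x^j)|<\epsilon$. The Mañé potential $S_A:\Sigma\times\Sigma\to\mathbb R\cup\{\pm\infty\}$ is $S_A(\mathbf x,\bar{\mathbf x})=\lim_{\epsilon\to0}S_A^\epsilon(\mathbf x,\bar{\mathbf x})$, where $S_A^\epsilon(\mathbf x,\bar{\mathbf x})=\inf\bigl[-\sum_{j=0}^{k-1}(A-\beta_A)(\mathbf y^j,\mathbf x^j)\bigr]$, the infimum being over all paths in $\mathcal P(\mathbf x,\bar{\mathbf x},\epsilon)$ ($\inf\emptyset=+\infty$). *)

theory Defs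
  imports "HOL-Probability.Probability"
begin

section \<open>One-sided subshifts of finite type and their natural extension\<close>

text \<open>
  Symbols are the natural numbers \<open>1, \<dots>, r\<close>; a matrix is a function of two indices of which only
  the values on \<open>{1..r} \<times> {1..r}\<close> matter.  A point \<open>(\<dots>, y\<^sub>1, y\<^sub>0)\<close> of the dual shift is the function
  \<open>y\<close> with \<open>y j = y\<^sub>j\<close>.
\<close>

type_synonym seq = "nat \<Rightarrow> nat"

definition zero_one_matrix :: "nat \<Rightarrow> (nat \<Rightarrow> nat \<Rightarrow> nat) \<Rightarrow> bool" where
  "zero_one_matrix r M \<longleftrightarrow> (\<forall>i\<in>{1..r}. \<forall>j\<in>{1..r}. M i j \<in> {0, 1})"

definition sft :: "nat \<Rightarrow> (nat \<Rightarrow> nat \<Rightarrow> nat) \<Rightarrow> seq set" where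
  "sft r M = {x. (\<forall>j. x j \<in> {1..r}) \<and> (\<forall>j. M (x j) (x (Suc j)) = 1)}"

definition dual_sft :: "nat \<Rightarrow> (nat \<Rightarrow> nat \<Rightarrow> nat) \<Rightarrow> seq set" where
  "dual_sft r M = {y. (\<forall>j. y j \<in> {1..r}) \<and> (\<forall>j. M (y (Suc j)) (y j) = 1)}"

definition hat_sft :: "nat \<Rightarrow> (nat \<Rightarrow> nat \<Rightarrow> nat) \<Rightarrow> (seq \<times> seq) set" where
  "hat_sft r M = {(y, x). y \<in> dual_sft r M \<and> x \<in> sft r M \<and> M (y 0) (x 0) = 1}"

definition dual_fibre :: "nat \<Rightarrow> (nat \<Rightarrow> nat \<Rightarrow> nat) \<Rightarrow> seq \<Rightarrow> seq set" where
  "dual_fibre r M x = {y \<in> dual_sft r M. (y, x) \<in> hat_sft r M}"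

definition shift :: "seq \<Rightarrow> seq" where
  "shift x = (\<lambda>j. x (Suc j))"

definition prepend :: "seq \<times> seq \<Rightarrow> seq" where
  "prepend = (\<lambda>(y, x). case_nat (y 0) x)"

definition seq_dist :: "real \<Rightarrow> seq \<Rightarrow> seq \<Rightarrow> real" where
  "seq_dist lam x x' = (if x = x' then 0 else lam ^ (LEAST j. x j \<noteq> x' j))"

definition hat_dist :: "real \<Rightarrow> seq \<times> seq \<Rightarrow> seq \<times> seq \<Rightarrow> real" where
  "hat_dist lam = (\<lambda>(y, x) (y', x'). max (seq_dist lam y y') (seq_dist lam x x'))"

lemma seq_dist_commute: "seq_dist lam x y = seq_dist lam y x"
  unfolding seq_dist_def by (simp add: eq_commute)

lemma seq_dist_ultra:
  assumes "0 < lam" "lam < 1"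
  shows "seq_dist lam x z \<le> max (seq_dist lam x y) (seq_dist lam y z)"
proof (cases "x = y \<or> y = z \<or> x = z")
  case True
  then show ?thesis using assms by (auto simp: seq_dist_def le_max_iff_disj)
next
  case False
  define n where "n = (LEAST j. x j \<noteq> z j)"
  from False have "\<exists>j. x j \<noteq> z j" by auto
  then have "x n \<noteq> z n" unfolding n_def by (rule LeastI_ex)
  then have "x n \<noteq> y n \<or> y n \<noteq> z n" by auto
  then have "(LEAST j. x j \<noteq> y j) \<le> n \<or> (LEAST j. y j \<noteq> z j) \<le> n"
    by (auto intro: Least_le)
  then have "lam ^ n \<le> lam ^ (LEAST j. x j \<noteq> y j) \<or> lam ^ n \<le> lam ^ (LEAST j. y j \<noteq> z j)"
    using assms by (auto intro: power_decreasing)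
  then show ?thesis using False by (auto simp: seq_dist_def n_def)
qed

lemma seq_dist_nonneg: "0 < lam \<Longrightarrow> 0 \<le> seq_dist lam x y"
  by (simp add: seq_dist_def)

lemma seq_dist_eq_0: "0 < lam \<Longrightarrow> seq_dist lam x y = 0 \<longleftrightarrow> x = y"
  by (simp add: seq_dist_def)

lemma Metric_space_seq_dist:
  assumes "0 < lam" "lam < 1"
  shows "Metric_space S (seq_dist lam)"
proof
  show "seq_dist lam x z \<le> seq_dist lam x y + seq_dist lam y z" for x y z
    using seq_dist_ultra[OF assms, of x z y] seq_dist_nonneg[OF assms(1), of x y]
      seq_dist_nonneg[OF assms(1), of y z] by linarith
qed (use assms in \<open>auto simp: seq_dist_nonneg seq_dist_eq_0 seq_dist_commute\<close>)

lemma Metric_space_hat_dist: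
  assumes "0 < lam" "lam < 1"
  shows "Metric_space S (hat_dist lam)"
proof
  interpret Metric_space UNIV "seq_dist lam" by (rule Metric_space_seq_dist[OF assms])
  show "0 \<le> hat_dist lam p q" for p q
    by (auto simp: hat_dist_def max_def split: prod.splits)
  show "hat_dist lam p q = hat_dist lam q p" for p q
    by (auto simp: hat_dist_def seq_dist_commute split: prod.splits)
  show "(hat_dist lam p q = 0) = (p = q)" for p q
  proof (cases p; cases q)
    fix a b c e assume "p = (a, b)" "q = (c, e)"
    then show ?thesis
      using seq_dist_nonneg[OF assms(1), of a c] seq_dist_nonneg[OF assms(1), of b e]
        seq_dist_eq_0[OF assms(1), of a c] seq_dist_eq_0[OF assms(1), of b e]
      unfolding hat_dist_def max_def by (simp, linarith)
  qed
  show "hat_dist lam p s \<le> hat_dist lam p q + hat_dist lam q s" for p q s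
  proof (cases p; cases q; cases s)
    fix a b c e f g assume "p = (a, b)" "q = (c, e)" "s = (f, g)"
    then show ?thesis
      using triangle[of a c f] triangle[of b e g] by (auto simp: hat_dist_def)
  qed
qed

abbreviation sft_topology :: "nat \<Rightarrow> (nat \<Rightarrow> nat \<Rightarrow> nat) \<Rightarrow> real \<Rightarrow> seq topology" where
  "sft_topology r M lam \<equiv> Metric_space.mtopology (sft r M) (seq_dist lam)"

abbreviation hat_topology :: "nat \<Rightarrow> (nat \<Rightarrow> nat \<Rightarrow> nat) \<Rightarrow> real \<Rightarrow> (seq \<times> seq) topology" where
  "hat_topology r M lam \<equiv> Metric_space.mtopology (hat_sft r M) (hat_dist lam)"

definition transitive_sft :: "nat \<Rightarrow> (nat \<Rightarrow> nat \<Rightarrow> nat) \<Rightarrow> real \<Rightarrow> bool" where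
  "transitive_sft r M lam \<longleftrightarrow>
     (\<forall>D E. openin (sft_topology r M lam) D \<and> D \<noteq> {} \<and> openin (sft_topology r M lam) E \<and> E \<noteq> {}
        \<longrightarrow> (\<exists>k\<ge>1. (shift ^^ k) ` D \<inter> E \<noteq> {}))"

definition holder_on :: "real \<Rightarrow> 'a set \<Rightarrow> ('a \<Rightarrow> 'a \<Rightarrow> real) \<Rightarrow> ('a \<Rightarrow> real) \<Rightarrow> bool" where
  "holder_on \<theta> S dst f \<longleftrightarrow> (\<exists>C. \<forall>p\<in>S. \<forall>q\<in>S. \<bar>f p - f q\<bar> \<le> C * dst p q powr \<theta>)"


section \<open>Holonomic probabilities and calibrated sub-actions\<close>

definition holonomic :: "nat \<Rightarrow> (nat \<Rightarrow> nat \<Rightarrow> nat) \<Rightarrow> real \<Rightarrow> (seq \<times> seq) measure set" where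
  "holonomic r M lam = {\<mu>. prob_space \<mu> \<and>
     sets \<mu> = sets (sigma (hat_sft r M) {U. openin (hat_topology r M lam) U}) \<and>
     (\<forall>f. continuous_map (sft_topology r M lam) euclideanreal f \<longrightarrow>
        (\<integral>(y, x). f (prepend (y, x)) \<partial>\<mu>) = (\<integral>(y, x). f x \<partial>\<mu>))}"

text \<open>
  The maximum over holonomic probabilities is written as a supremum; the two agree, since
  the set of holonomic probabilities is weak* compact and the potentials are continuous.
\<close>

definition beta ::
  "nat \<Rightarrow> (nat \<Rightarrow> nat \<Rightarrow> nat) \<Rightarrow> real \<Rightarrow> (seq \<times> seq \<Rightarrow> real) \<Rightarrow> real" where
  "beta r M lam A = (SUP \<mu>\<in>holonomic r M lam. \<integral>p. A p \<partial>\<mu>)"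

definition calibrated_subaction ::
  "nat \<Rightarrow> (nat \<Rightarrow> nat \<Rightarrow> nat) \<Rightarrow> real \<Rightarrow> (seq \<times> seq \<Rightarrow> real) \<Rightarrow> (seq \<Rightarrow> real) \<Rightarrow> bool" where
  "calibrated_subaction r M lam A u \<longleftrightarrow>
     continuous_map (sft_topology r M lam) euclideanreal u \<and>
     (\<forall>x\<in>sft r M.
        (\<exists>y\<in>dual_fibre r M x. u x = u (prepend (y, x)) - A (y, x) + beta r M lam A) \<and>
        (\<forall>y\<in>dual_fibre r M x. u x \<le> u (prepend (y, x)) - A (y, x) + beta r M lam A))"


section \<open>Paths, non-wandering points and the Mane potential\<close>

text \<open>\<open>paths r M lam x x' \<epsilon>\<close>: the paths start at \<open>x'\<close> and end within \<open>\<epsilon>\<close> of \<open>x\<close>.\<close>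

definition paths ::
  "nat \<Rightarrow> (nat \<Rightarrow> nat \<Rightarrow> nat) \<Rightarrow> real \<Rightarrow> seq \<Rightarrow> seq \<Rightarrow> real \<Rightarrow> (seq \<times> seq) list set" where
  "paths r M lam x x' \<epsilon> = {p. p \<noteq> [] \<and> set p \<subseteq> hat_sft r M \<and> snd (hd p) = x' \<and>
     (\<forall>j. Suc j < length p \<longrightarrow> snd (p ! Suc j) = prepend (p ! j)) \<and>
     seq_dist lam (prepend (last p)) x < \<epsilon>}"

definition path_sum ::
  "nat \<Rightarrow> (nat \<Rightarrow> nat \<Rightarrow> nat) \<Rightarrow> real \<Rightarrow> (seq \<times> seq \<Rightarrow> real) \<Rightarrow> (seq \<times> seq) list \<Rightarrow> real" where
  "path_sum r M lam A p = (\<Sum>j<length p. A (p ! j) - beta r M lam A)"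

definition nonwandering ::
  "nat \<Rightarrow> (nat \<Rightarrow> nat \<Rightarrow> nat) \<Rightarrow> real \<Rightarrow> (seq \<times> seq \<Rightarrow> real) \<Rightarrow> seq set" where
  "nonwandering r M lam A =
     {x \<in> sft r M. \<forall>\<epsilon>>0. \<exists>p\<in>paths r M lam x x \<epsilon>. \<bar>path_sum r M lam A p\<bar> < \<epsilon>}"

definition mane_eps ::
  "nat \<Rightarrow> (nat \<Rightarrow> nat \<Rightarrow> nat) \<Rightarrow> real \<Rightarrow> (seq \<times> seq \<Rightarrow> real) \<Rightarrow> real \<Rightarrow> seq \<Rightarrow> seq \<Rightarrow> ereal" where
  "mane_eps r M lam A \<epsilon> x x' = (INF p\<in>paths r M lam x x' \<epsilon>. ereal (- path_sum r M lam A p))"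

definition mane ::
  "nat \<Rightarrow> (nat \<Rightarrow> nat \<Rightarrow> nat) \<Rightarrow> real \<Rightarrow> (seq \<times> seq \<Rightarrow> real) \<Rightarrow> seq \<Rightarrow> seq \<Rightarrow> ereal" where
  "mane r M lam A x x' = Lim (at_right 0) (\<lambda>\<epsilon>. mane_eps r M lam A \<epsilon> x x')"

end

theory Submission
  imports Defs "HOL-Real_Asymp.Real_Asymp"
begin

text \<open>
  Write the cost of a path as the sum of \<open>\<beta> - A\<close> along it, so that the Mane potential is
  the least asymptotic cost of travelling backwards from \<open>z\<close> to \<open>x\<close>.

  Three facts carry the proof.  The first is a shadowing estimate: a path from \<open>z\<close> may be replayed
  from any \<open>z'\<close> with the same first symbol, by keeping its dual coordinates (\<open>rebase\<close>).  The
  two replays approach each other at rate \<open>lam\<close>, so their costs differ by at most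
  \<open>K\<^sub>1 * d z' z powr \<theta>\<close>, however long the path is (\<open>cost_rebase\<close>).

  The second is that costs are bounded below (\<open>cost_bounded_below\<close>).  The uniform probability on
  a closed path is holonomic, whence closed paths have nonnegative cost by the definition of
  \<open>\<beta>\<close>.  By transitivity every path can be prolonged at bounded cost until its endpoint has the
  first symbol of its starting point; replaying the result from the periodic point that its word
  defines gives a closed path, at a bounded change of cost.  This elementary argument replaces the
  duality between holonomic probabilities and sub-actions.

  The third is where the non-wandering hypothesis enters.  If \<open>w\<close> shares its first symbol with
  \<open>x\<close>, then replaying an almost free almost loop at \<open>x\<close> again and again from \<open>w\<close> moves
  geometrically towards \<open>x\<close>, so that the total cost is at most
  \<open>K\<^sub>2 * d w x powr \<theta>\<close> plus an arbitrarily small error (\<open>cheap_return\<close>).  Hence a path whose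
  endpoint \<open>e\<close> satisfies \<open>d e x < 1\<close> costs at least the Mane potential minus
  \<open>K\<^sub>2 * d e x powr \<theta>\<close>, with no limit to be taken (\<open>mane_real_le\<close>).

  Everything follows from this last estimate together with the existence of almost optimal paths.
  Replaying an almost optimal path gives Hoelder continuity; putting one step in front of an almost
  optimal path gives the sub-action inequality; removing the first step of an almost optimal path
  shows that the infimum over the fibre is the value of the potential, and it is attained because
  the fibre is compact.
\<close>

section \<open>The metric on sequences\<close>

lemma seq_dist_le_1: "0 < lam \<Longrightarrow> lam < 1 \<Longrightarrow> seq_dist lam x y \<le> 1"
  by (simp add: seq_dist_def power_le_one)

lemma seq_dist_less_1_iff:
  assumes "0 < lam" "lam < 1"
  shows "seq_dist lam x y < 1 \<longleftrightarrow> x 0 = y 0"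
proof (cases "x 0 = y 0 \<and> x \<noteq> y")
  case True
  then obtain j where "x j \<noteq> y j" by auto
  then have "x (LEAST j. x j \<noteq> y j) \<noteq> y (LEAST j. x j \<noteq> y j)" by (rule LeastI)
  with True have "(LEAST j. x j \<noteq> y j) \<noteq> 0" by metis
  with True assms show ?thesis by (simp add: seq_dist_def power_less_one_iff)
next
  case False
  then show ?thesis
  proof (cases "x = y")
    case nxy: False
    with False have "(LEAST j. x j \<noteq> y j) = 0" by (intro Least_eq_0) auto
    with False nxy show ?thesis by (auto simp: seq_dist_def)
  qed (simp add: seq_dist_def)
qed

lemma seq_dist_prepend:
  "seq_dist lam (prepend (y, x)) (prepend (y, x')) = lam * seq_dist lam x x'"
proof (cases "x = x'")
  case False
  then obtain j where j: "x j \<noteq> x' j" by auto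
  have neq: "prepend (y, x) \<noteq> prepend (y, x')"
    using j by (auto simp: prepend_def fun_eq_iff intro!: exI[of _ "Suc j"])
  have "(LEAST i. prepend (y, x) i \<noteq> prepend (y, x') i)
      = Suc (LEAST i. prepend (y, x) (Suc i) \<noteq> prepend (y, x') (Suc i))"
    using j by (intro Least_Suc[of _ "Suc j"]) (auto simp: prepend_def)
  then show ?thesis using False neq by (simp add: seq_dist_def prepend_def)
qed (simp add: seq_dist_def)

lemma seq_dist_agree:
  assumes "0 < lam" "lam < 1" "\<And>i. i < n \<Longrightarrow> x i = y i"
  shows "seq_dist lam x y \<le> lam ^ n"
proof (cases "x = y")
  case False
  then have "\<exists>j. x j \<noteq> y j" by auto
  then have "x (LEAST j. x j \<noteq> y j) \<noteq> y (LEAST j. x j \<noteq> y j)" by (rule LeastI_ex)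
  then have "n \<le> (LEAST j. x j \<noteq> y j)" using assms(3) not_le by metis
  with False assms(1,2) show ?thesis by (auto simp: seq_dist_def intro: power_decreasing)
qed (use assms in \<open>simp add: seq_dist_def\<close>)

lemma prepend_nonexpansive:
  assumes "0 < lam" "lam < 1"
  shows "seq_dist lam (prepend p) (prepend q) \<le> hat_dist lam p q"
proof (cases p; cases q)
  fix y x y' x' assume pq: "p = (y, x)" "q = (y', x')"
  show ?thesis
  proof (cases "y 0 = y' 0")
    case True
    then have "prepend p = prepend (y', x)" by (simp add: pq prepend_def)
    then have "seq_dist lam (prepend p) (prepend q) = lam * seq_dist lam x x'"
      by (simp add: pq seq_dist_prepend)
    also have "\<dots> \<le> seq_dist lam x x'"
      using assms seq_dist_nonneg[OF assms(1)] by (simp add: mult_left_le_one_le)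
    finally show ?thesis by (simp add: pq hat_dist_def)
  next
    case False
    then have "seq_dist lam y y' = 1"
      using seq_dist_less_1_iff[OF assms] seq_dist_le_1[OF assms]
      by (metis less_eq_real_def)
    then show ?thesis using seq_dist_le_1[OF assms, of "prepend p" "prepend q"]
      by (simp add: pq hat_dist_def max_def)
  qed
qed

lemma snd_nonexpansive: "seq_dist lam (snd p) (snd q) \<le> hat_dist lam p q"
  by (cases p; cases q) (simp add: hat_dist_def)

lemma nonexpansive_continuous_map:
  assumes "Metric_space S d" "Metric_space T e"
    and "\<And>p. p \<in> S \<Longrightarrow> g p \<in> T" and "\<And>p q. p \<in> S \<Longrightarrow> q \<in> S \<Longrightarrow> e (g p) (g q) \<le> d p q"
  shows "continuous_map (Metric_space.mtopology S d) (Metric_space.mtopology T e) g"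
  unfolding Metric_space.metric_continuous_map[OF assms(1,2)]
  using assms(3,4) by (blast intro: le_less_trans)

lemma holder_continuous_map:
  assumes "Metric_space S d" "holder_on \<theta> S d f" "0 < \<theta>"
  shows "continuous_map (Metric_space.mtopology S d) euclideanreal f"
proof -
  interpret Metric_space S d by fact
  obtain C where C: "\<And>p q. p \<in> S \<Longrightarrow> q \<in> S \<Longrightarrow> \<bar>f p - f q\<bar> \<le> C * d p q powr \<theta>"
    using assms(2) by (auto simp: holder_on_def)
  have "continuous_map mtopology Met_TC.mtopology f"
    unfolding metric_continuous_map[OF Met_TC.Metric_space_axioms]
  proof (intro conjI ballI allI impI)
    fix p \<epsilon> assume p: "p \<in> S" and \<epsilon>: "(0::real) < \<epsilon>"
    define D where "D = \<bar>C\<bar> + 1"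
    define \<delta> where "\<delta> = (\<epsilon> / D) powr (1 / \<theta>)"
    have D: "0 < D" by (simp add: D_def)
    have pos: "0 < \<delta>" using \<epsilon> D by (simp add: \<delta>_def)
    have "dist (f p) (f q) < \<epsilon>" if q: "q \<in> S" "d p q < \<delta>" for q
    proof -
      have "d p q powr \<theta> < \<delta> powr \<theta>" using q assms(3) by (intro powr_less_mono2) auto
      also have "\<delta> powr \<theta> = \<epsilon> / D" using \<epsilon> D assms(3) by (simp add: \<delta>_def powr_powr)
      finally have "d p q powr \<theta> * D < \<epsilon>" using D by (simp add: pos_less_divide_eq)
      moreover have "C * d p q powr \<theta> \<le> D * d p q powr \<theta>"
        by (rule mult_right_mono) (simp_all add: D_def)
      ultimately show ?thesis using C[OF p q(1)] by (simp add: dist_real_def mult.commute)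
    qed
    then show "\<exists>\<delta>>0. \<forall>q. q \<in> S \<and> d p q < \<delta> \<longrightarrow> dist (f p) (f q) < \<epsilon>" using pos by blast
  qed auto
  then show ?thesis by simp
qed

section \<open>Compactness of the fibres of the natural extension\<close>

lemma open_cylinder: "open {y' :: seq. \<forall>i<n. y' i = y i}"
proof -
  have "{y' :: seq. \<forall>i<n. y' i = y i} = Pi\<^sub>E UNIV (\<lambda>i. if i < n then {y i} else UNIV)"
    by (auto simp: PiE_def Pi_def split: if_splits)
  moreover have "open \<dots>"
  proof (rule open_PiE)
    show "finite {i. (if i < n then {y i} else UNIV) \<noteq> UNIV}"
      by (rule finite_subset[of _ "{..<n}"]) auto
  qed (simp add: Topological_Spaces.open_discrete)
  ultimately show ?thesis by simp
qed

text \<open>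
  Cylinders form a neighbourhood basis of the product topology.  This form of continuity lets
  estimates in \<open>seq_dist\<close> be used with the compactness theory of the product topology.
\<close>

lemma continuous_on_cylinders:
  fixes g :: "seq \<Rightarrow> real"
  assumes "\<And>y e. y \<in> F \<Longrightarrow> 0 < e \<Longrightarrow> \<exists>n. \<forall>y'\<in>F. (\<forall>i<n. y' i = y i) \<longrightarrow> \<bar>g y' - g y\<bar> < e"
  shows "continuous_on F g"
  unfolding continuous_on_def
proof (intro ballI tendstoI)
  fix y e assume "y \<in> F" "(0::real) < e"
  then obtain n where n: "\<forall>y'\<in>F. (\<forall>i<n. y' i = y i) \<longrightarrow> \<bar>g y' - g y\<bar> < e" using assms by blast
  show "\<forall>\<^sub>F y' in at y within F. dist (g y') (g y) < e"
    unfolding eventually_at_topological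
    using n open_cylinder[of n y]
    by (intro exI[of _ "{y'. \<forall>i<n. y' i = y i}"]) (auto simp: dist_real_def)
qed

text \<open>
  The fibre is closed in a product of finite discrete spaces, since each of its defining conditions
  involves finitely many coordinates.
\<close>

lemma compact_dual_fibre: "compact (dual_fibre r M z)"
proof -
  have "compactin (product_topology (\<lambda>i. euclidean :: nat topology) UNIV) (Pi\<^sub>E UNIV (\<lambda>i::nat. {1..r}))"
    unfolding compactin_PiE by (auto intro: finite_imp_compact)
  then have K: "compact (Pi\<^sub>E UNIV (\<lambda>i::nat. {1..r}))" by (simp add: euclidean_product_topology)
  have "\<exists>T. open T \<and> y \<in> T \<and> T \<subseteq> - dual_fibre r M z" if y: "y \<in> - dual_fibre r M z" for y
  proof -
    have "\<exists>n. \<forall>y'. (\<forall>i<n. y' i = y i) \<longrightarrow> y' \<notin> dual_fibre r M z"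
    proof (rule ccontr)
      assume "\<not> ?thesis"
      then have *: "\<exists>y'. (\<forall>i<n. y' i = y i) \<and> y' \<in> dual_fibre r M z" for n by blast
      have "y j \<in> {1..r} \<and> M (y (Suc j)) (y j) = 1 \<and> z \<in> sft r M \<and> M (y 0) (z 0) = 1" for j
      proof -
        obtain y' where y': "\<forall>i<Suc (Suc j). y' i = y i" "y' \<in> dual_fibre r M z" using * by blast
        from y'(2) have "y' j \<in> {1..r} \<and> M (y' (Suc j)) (y' j) = 1 \<and> z \<in> sft r M \<and> M (y' 0) (z 0) = 1"
          by (simp add: dual_fibre_def hat_sft_def dual_sft_def)
        moreover have "y' j = y j" "y' (Suc j) = y (Suc j)" "y' 0 = y 0" using y'(1) by simp_all
        ultimately show ?thesis by metis
      qed
      then have "y \<in> dual_fibre r M z" by (simp add: dual_fibre_def hat_sft_def dual_sft_def)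
      with y show False by simp
    qed
    then obtain n where "\<forall>y'. (\<forall>i<n. y' i = y i) \<longrightarrow> y' \<notin> dual_fibre r M z" ..
    then show ?thesis by (intro exI[of _ "{y'. \<forall>i<n. y' i = y i}"]) (use open_cylinder in auto)
  qed
  then have "open (- dual_fibre r M z)" by (subst open_subopen) blast
  then have "closed (dual_fibre r M z)" by (simp add: closed_def)
  with K have "compact (Pi\<^sub>E UNIV (\<lambda>i::nat. {1..r}) \<inter> dual_fibre r M z)" by (rule compact_Int_closed)
  moreover have "dual_fibre r M z \<subseteq> Pi\<^sub>E UNIV (\<lambda>i::nat. {1..r})"
    by (auto simp: dual_fibre_def dual_sft_def)
  ultimately show ?thesis by (simp add: Int_absorb1)
qed

section \<open>Chains, their endpoints, and moving the starting point\<close>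

text \<open>
  A path is handled as a list of steps together with its starting point.  Unlike \<open>paths\<close>, the
  recursive predicate admits the empty list; the starting point is then its own endpoint, which
  makes concatenation and the removal of a first step uniform.
\<close>

fun chain :: "(seq \<times> seq) set \<Rightarrow> seq \<Rightarrow> (seq \<times> seq) list \<Rightarrow> bool" where
  "chain H z [] \<longleftrightarrow> True"
| "chain H z (q # p) \<longleftrightarrow> q \<in> H \<and> snd q = z \<and> chain H (prepend q) p"

fun endpoint :: "seq \<Rightarrow> (seq \<times> seq) list \<Rightarrow> seq" where
  "endpoint z [] = z"
| "endpoint z (q # p) = endpoint (prepend q) p"

text \<open>
  The path that starts at another point and makes the same choices: it keeps only the dual
  coordinates of the given one.
\<close>

fun rebase :: "seq \<Rightarrow> (seq \<times> seq) list \<Rightarrow> (seq \<times> seq) list" where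
  "rebase z [] = []"
| "rebase z (q # p) = (fst q, z) # rebase (prepend (fst q, z)) p"

lemma chain_append: "chain H z (p @ p') \<longleftrightarrow> chain H z p \<and> chain H (endpoint z p) p'"
  by (induction p arbitrary: z) auto

lemma endpoint_append: "endpoint z (p @ p') = endpoint (endpoint z p) p'"
  by (induction p arbitrary: z) auto

lemma length_rebase [simp]: "length (rebase z p) = length p"
  by (induction p arbitrary: z) auto

lemma rebase_eq_Nil_iff [simp]: "rebase z p = [] \<longleftrightarrow> p = []"
  by (metis length_rebase length_0_conv)

lemma chain_set: "chain H z p \<Longrightarrow> set p \<subseteq> H"
  by (induction p arbitrary: z) auto

lemma chain_iff_nth:
  assumes "p \<noteq> []"
  shows "chain H z p \<longleftrightarrow> set p \<subseteq> H \<and> snd (hd p) = z \<and>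
    (\<forall>j. Suc j < length p \<longrightarrow> snd (p ! Suc j) = prepend (p ! j))"
  using assms
proof (induction p arbitrary: z)
  case (Cons q p)
  show ?case
  proof (cases p)
    case (Cons q' p')
    have "(\<forall>j. Suc j < length (q # p) \<longrightarrow> snd ((q # p) ! Suc j) = prepend ((q # p) ! j)) \<longleftrightarrow>
        snd (hd p) = prepend q \<and> (\<forall>j. Suc j < length p \<longrightarrow> snd (p ! Suc j) = prepend (p ! j))"
      unfolding Cons by (auto simp: nth_Cons split: nat.splits)
    then show ?thesis using Cons.IH[of "prepend q"] Cons by auto
  qed auto
qed simp

lemma endpoint_last: "p \<noteq> [] \<Longrightarrow> endpoint z p = prepend (last p)"
  by (induction p arbitrary: z) auto

lemma paths_chain:
  "paths r M lam x z \<epsilon> =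
     {p. p \<noteq> [] \<and> chain (hat_sft r M) z p \<and> seq_dist lam (endpoint z p) x < \<epsilon>}"
  by (auto simp: paths_def chain_iff_nth endpoint_last)

text \<open>
  The endpoint of a chain of length \<open>n\<close> is a word of length \<open>n\<close> followed by the starting point;
  the word depends only on the dual coordinates (\<open>endpoint_rebase_head\<close>).
\<close>

lemma endpoint_tail: "chain H z p \<Longrightarrow> endpoint z p (i + length p) = z i"
proof (induction p arbitrary: z i)
  case (Cons q p)
  then have "endpoint (prepend q) p (Suc i + length p) = prepend q (Suc i)" by (metis chain.simps(2))
  moreover have "prepend q (Suc i) = z i" using Cons.prems by (cases q) (auto simp: prepend_def)
  ultimately show ?case by simp
qed simp

lemma chain_rebase_weak: "chain UNIV z (rebase z p)"
  by (induction p arbitrary: z) auto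

lemma endpoint_rebase_head:
  "chain H z p \<Longrightarrow> i < length p \<Longrightarrow> endpoint z' (rebase z' p) i = endpoint z p i"
proof (induction p arbitrary: z z' i)
  case (Cons q p)
  show ?case
  proof (cases "i < length p")
    case True
    then show ?thesis using Cons by auto
  next
    case False
    then have i: "i = 0 + length p" using Cons.prems by auto
    have "endpoint (prepend q) p i = prepend q 0"
      unfolding i by (rule endpoint_tail[of H]) (use Cons.prems in auto)
    moreover have "endpoint (prepend (fst q, z')) (rebase (prepend (fst q, z')) p) i = prepend (fst q, z') 0"
      using endpoint_tail[OF chain_rebase_weak, of "prepend (fst q, z')" p 0] by (simp add: i)
    ultimately show ?thesis by (cases q) (simp add: prepend_def)
  qed
qed simp

text \<open>
  Each step prepends the same symbol to both points, which contracts their distance by \<open>lam\<close>.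
\<close>

lemma seq_dist_endpoint_rebase:
  assumes "chain H z p"
  shows "seq_dist lam (endpoint z' (rebase z' p)) (endpoint z p)
       = lam ^ length p * seq_dist lam z' z"
  using assms
proof (induction p arbitrary: z z')
  case (Cons q p)
  then have "q = (fst q, z)" by (cases q) auto
  then have "seq_dist lam (prepend (fst q, z')) (prepend q) = lam * seq_dist lam z' z"
    by (metis seq_dist_prepend)
  then show ?case using Cons by auto
qed simp

text \<open>
  This is the holonomy condition for the counting measure on a chain, with a boundary term that
  vanishes when the chain is closed.
\<close>

lemma chain_telescope:
  fixes f :: "seq \<Rightarrow> real"
  assumes "chain H z p"
  shows "(\<Sum>q\<leftarrow>p. f (prepend q)) - (\<Sum>q\<leftarrow>p. f (snd q)) = f (endpoint z p) - f z"
  using assms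
proof (induction p arbitrary: z)
  case (Cons q p)
  then have "(\<Sum>q\<leftarrow>p. f (prepend q)) - (\<Sum>q\<leftarrow>p. f (snd q)) = f (endpoint (prepend q) p) - f (prepend q)"
    by auto
  with Cons.prems show ?case by (simp add: algebra_simps)
qed simp

lemma prepend_in_sft: "q \<in> hat_sft r M \<Longrightarrow> prepend q \<in> sft r M"
  by (auto simp: hat_sft_def sft_def dual_sft_def prepend_def split: nat.splits)

lemma endpoint_in_sft:
  "chain (hat_sft r M) z p \<Longrightarrow> z \<in> sft r M \<Longrightarrow> endpoint z p \<in> sft r M"
  by (induction p arbitrary: z) (auto simp: prepend_in_sft)

lemma chain_rebase:
  assumes "chain (hat_sft r M) z p" "z' \<in> sft r M" "z' 0 = z 0"
  shows "chain (hat_sft r M) z' (rebase z' p)"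
  using assms
proof (induction p arbitrary: z z')
  case (Cons q p)
  then have q: "(fst q, z') \<in> hat_sft r M" by (cases q) (auto simp: hat_sft_def)
  have "prepend (fst q, z') 0 = prepend q 0" by (cases q) (simp add: prepend_def)
  then show ?case using Cons q prepend_in_sft[OF q] by auto
qed simp


section \<open>Costs of chains\<close>

lemma shift_pow_apply: "(shift ^^ k) z i = z (i + k)"
  by (induction k arbitrary: i) (auto simp: shift_def)

lemma shift_pow_in_sft: "z \<in> sft r M \<Longrightarrow> (shift ^^ k) z \<in> sft r M"
  by (auto simp: sft_def shift_pow_apply)

locale sft_potential =
  fixes r :: nat and M :: "nat \<Rightarrow> nat \<Rightarrow> nat" and lam \<theta> C :: real and A :: "seq \<times> seq \<Rightarrow> real"
  assumes lam_pos: "0 < lam" and lam_less_1: "lam < 1" and theta_pos: "0 < \<theta>"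
    and transitive: "transitive_sft r M lam"
    and C_nonneg: "0 \<le> C"
    and holder: "\<And>p q. p \<in> hat_sft r M \<Longrightarrow> q \<in> hat_sft r M \<Longrightarrow>
          \<bar>A p - A q\<bar> \<le> C * hat_dist lam p q powr \<theta>"
begin

abbreviation "X \<equiv> sft r M"
abbreviation "H \<equiv> hat_sft r M"
abbreviation "d \<equiv> seq_dist lam"
abbreviation "\<beta> \<equiv> beta r M lam A"

definition cost :: "(seq \<times> seq) list \<Rightarrow> real" where
  "cost p = (\<Sum>q\<leftarrow>p. \<beta> - A q)"

text \<open>
  \<open>\<kappa>\<close> is the factor by which \<open>d s t powr \<theta>\<close> contracts in one step, and \<open>K\<^sub>1\<close> is the sum
  of the geometric series \<open>C * \<kappa> ^ j\<close> of the errors along a chain.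
\<close>

definition \<kappa> :: real where "\<kappa> = lam powr \<theta>"
definition K\<^sub>1 :: real where "K\<^sub>1 = C / (1 - \<kappa>)"

lemma kappa: "0 < \<kappa>" "\<kappa> < 1"
  using lam_pos powr_less_mono2[OF theta_pos, of lam 1] lam_less_1 by (auto simp: \<kappa>_def)

lemma K1_nonneg: "0 \<le> K\<^sub>1"
  using kappa C_nonneg by (simp add: K\<^sub>1_def)

lemma K1_eq: "C + K\<^sub>1 * \<kappa> = K\<^sub>1"
  using kappa by (simp add: K\<^sub>1_def field_simps)

lemma cost_simps [simp]: "cost [] = 0" "cost (q # p) = \<beta> - A q + cost p"
    "cost (p @ p') = cost p + cost p'"
  by (auto simp: cost_def)

lemma path_sum_eq_cost: "path_sum r M lam A p = - cost p"
  unfolding path_sum_def cost_def sum_list_sum_nth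
  by (simp add: atLeast0LessThan sum_negf[symmetric])

lemma d_nonneg [simp]: "0 \<le> d s t"
  by (rule seq_dist_nonneg[OF lam_pos])

text \<open>
  The error of the first step is at most \<open>C * d z' z powr \<theta>\<close>, and the remaining chain starts from
  points that are closer by the factor \<open>lam\<close>; the fixed-point equation \<open>K1_eq\<close> closes the
  induction.
\<close>

lemma cost_rebase:
  assumes "chain H z p" "z' \<in> X" "z' 0 = z 0"
  shows "\<bar>cost (rebase z' p) - cost p\<bar> \<le> K\<^sub>1 * d z' z powr \<theta>"
  using assms
proof (induction p arbitrary: z z')
  case (Cons q p)
  obtain y where q: "q = (y, z)" using Cons.prems by (cases q) auto
  have q': "(y, z') \<in> H" using Cons.prems q by (auto simp: hat_sft_def)
  have "\<bar>A (y, z') - A q\<bar> \<le> C * hat_dist lam (y, z') q powr \<theta>"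
    using holder q' Cons.prems by auto
  also have "hat_dist lam (y, z') q = d z' z"
    by (simp add: q hat_dist_def seq_dist_eq_0[OF lam_pos, THEN iffD2] max_def)
  finally have 1: "\<bar>A (y, z') - A q\<bar> \<le> C * d z' z powr \<theta>" .
  have "\<bar>cost (rebase (prepend (y, z')) p) - cost p\<bar>
      \<le> K\<^sub>1 * d (prepend (y, z')) (prepend q) powr \<theta>"
    using Cons.prems q by (intro Cons.IH) (auto simp: prepend_in_sft[OF q'], simp add: prepend_def)
  also have "d (prepend (y, z')) (prepend q) powr \<theta> = \<kappa> * d z' z powr \<theta>"
    using lam_pos by (simp add: q seq_dist_prepend powr_mult \<kappa>_def)
  finally have "\<bar>cost (rebase z' (q # p)) - cost (q # p)\<bar> \<le> (C + K\<^sub>1 * \<kappa>) * d z' z powr \<theta>"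
    using 1 by (simp add: q algebra_simps)
  then show ?case unfolding K1_eq .
qed (simp add: K1_nonneg)

lemma bounded_potential: "\<exists>B\<ge>0. \<forall>q\<in>H. \<bar>A q\<bar> \<le> B"
proof (cases "H = {}")
  case False
  then obtain q0 where q0: "q0 \<in> H" by auto
  have "\<bar>A q\<bar> \<le> \<bar>A q0\<bar> + C" if q: "q \<in> H" for q
  proof -
    have "0 \<le> hat_dist lam q q0" "hat_dist lam q q0 \<le> 1"
      using seq_dist_le_1[OF lam_pos lam_less_1]
      by (auto simp: hat_dist_def le_max_iff_disj split: prod.splits)
    then have "C * hat_dist lam q q0 powr \<theta> \<le> C"
      using C_nonneg theta_pos by (intro mult_left_le powr_le1) auto
    then show ?thesis using holder[OF q q0] by linarith
  qed
  then show ?thesis using C_nonneg by (intro exI[of _ "\<bar>A q0\<bar> + C"]) auto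
qed auto

lemma transition_point:
  assumes "s \<in> X" "t \<in> X"
  shows "\<exists>w\<in>X. \<exists>k\<ge>1. w 0 = s 0 \<and> w k = t 0"
proof -
  interpret Metric_space X d by (rule Metric_space_seq_dist[OF lam_pos lam_less_1])
  have "mball s 1 \<noteq> {}" "mball t 1 \<noteq> {}" using assms centre_in_mball_iff[of _ 1] by fastforce+
  with transitive openin_mball
  obtain k where k: "k \<ge> 1" "(shift ^^ k) ` mball s 1 \<inter> mball t 1 \<noteq> {}"
    unfolding transitive_sft_def by meson
  then obtain w where w: "w \<in> mball s 1" "(shift ^^ k) w \<in> mball t 1" by blast
  then have "w \<in> X" "s 0 = w 0" "t 0 = (shift ^^ k) w 0"
    using seq_dist_less_1_iff[OF lam_pos lam_less_1] by auto
  with k(1) show ?thesis by (metis add_0 shift_pow_apply)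
qed

text \<open>
  Only the finitely many pairs of first symbols matter, so the transition times can be bounded.
\<close>

lemma uniform_transition_point:
  "\<exists>N. \<forall>s\<in>X. \<forall>t\<in>X. \<exists>w\<in>X. \<exists>k\<in>{1..N}. w 0 = s 0 \<and> w k = t 0"
proof -
  define P where "P = (\<lambda>s. s 0) ` X \<times> (\<lambda>s. s 0) ` X"
  have "P \<subseteq> {1..r} \<times> {1..r}" by (auto simp: P_def sft_def)
  then have fin: "finite P" by (rule finite_subset) auto
  have "\<forall>ab\<in>P. \<exists>k. k \<ge> 1 \<and> (\<exists>w\<in>X. w 0 = fst ab \<and> w k = snd ab)"
    unfolding P_def using transition_point by fastforce
  then obtain f where f: "\<And>ab. ab \<in> P \<Longrightarrow> f ab \<ge> 1 \<and> (\<exists>w\<in>X. w 0 = fst ab \<and> w (f ab) = snd ab)"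
    by metis
  show ?thesis
  proof (intro exI[of _ "Max (f ` P)"] ballI)
    fix s t assume "s \<in> X" "t \<in> X"
    then have "(s 0, t 0) \<in> P" by (auto simp: P_def)
    with f[OF this] fin show "\<exists>w\<in>X. \<exists>k\<in>{1..Max (f ` P)}. w 0 = s 0 \<and> w k = t 0"
      by (auto intro!: bexI[of _ "f (s 0, t 0)"])
  qed
qed

text \<open>
  By transitivity every symbol that occurs in the subshift recurs, hence has a predecessor that
  occurs as well; predecessors are chosen one after the other.
\<close>

lemma dual_point:
  assumes "s \<in> X"
  obtains y where "y \<in> dual_sft r M" "y 0 = s 0"
proof -
  have "\<exists>y. \<forall>n. (\<exists>t\<in>X. t 0 = y n) \<and> M (y (Suc n)) (y n) = 1 \<and> (n = 0 \<longrightarrow> y n = s 0)"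
  proof -
    have "\<exists>y. \<forall>n. ((\<exists>t\<in>X. t 0 = y n) \<and> (n = 0 \<longrightarrow> y n = s 0)) \<and> M (y (Suc n)) (y n) = 1"
    proof (rule dependent_nat_choice)
      fix a n assume "(\<exists>t\<in>X. t 0 = a) \<and> (n = (0::nat) \<longrightarrow> a = s 0)"
      then obtain t where t: "t \<in> X" "t 0 = a" by auto
      then obtain w k where w: "w \<in> X" "k \<ge> 1" "w k = a" using transition_point[of t t] by auto
      then have "M (w (k - 1)) a = 1" by (auto simp: sft_def dest!: spec[of _ "k - 1"])
      moreover have "\<exists>t\<in>X. t 0 = w (k - 1)"
        by (rule bexI[OF _ shift_pow_in_sft[OF w(1), of "k - 1"]]) (simp add: shift_pow_apply)
      ultimately show "\<exists>b. ((\<exists>t\<in>X. t 0 = b) \<and> (Suc n = 0 \<longrightarrow> b = s 0)) \<and> M b a = 1" by auto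
    qed (use assms in auto)
    then show ?thesis by blast
  qed
  then obtain y where y: "\<And>n. \<exists>t\<in>X. t 0 = y n" "\<And>n. M (y (Suc n)) (y n) = 1" "y 0 = s 0"
    by blast
  have "y n \<in> {1..r}" for n
    using y(1)[of n] unfolding sft_def by (metis (mono_tags, lifting) mem_Collect_eq)
  with y(2) have "y \<in> dual_sft r M" by (simp add: dual_sft_def)
  then show ?thesis using y(3) that by blast
qed

text \<open>
  The chain reads the symbols of \<open>w\<close> at the positions \<open>k - 1, \<dots>, 0\<close> backwards, prepending
  them to \<open>e\<close>.
\<close>

lemma chain_to_symbol:
  assumes "w \<in> X" "e \<in> X" "w k = e 0"
  shows "\<exists>q. chain H e q \<and> length q = k \<and> endpoint e q 0 = w 0"
  using assms
proof (induction k arbitrary: e)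
  case (Suc k)
  obtain y where y: "y \<in> dual_sft r M" "y 0 = w k"
    using dual_point[OF shift_pow_in_sft[OF Suc.prems(1), of k]] by (auto simp: shift_pow_apply)
  have "M (w k) (w (Suc k)) = 1" using Suc.prems(1) by (simp add: sft_def)
  then have "M (y 0) (e 0) = 1" using y(2) Suc.prems(3) by simp
  then have h: "(y, e) \<in> H" using y(1) Suc.prems(2) by (simp add: hat_sft_def)
  have "w k = prepend (y, e) 0" using y(2) by (simp add: prepend_def)
  from Suc.IH[OF Suc.prems(1) prepend_in_sft[OF h] this]
  obtain q where q: "chain H (prepend (y, e)) q \<and> length q = k \<and> endpoint (prepend (y, e)) q 0 = w 0" ..
  show ?case by (rule exI[of _ "(y, e) # q"]) (simp add: q h)
qed auto

lemma bounded_cost_connection: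
  "\<exists>D\<ge>0. \<forall>s\<in>X. \<forall>e\<in>X.
    \<exists>q. chain H e q \<and> q \<noteq> [] \<and> endpoint e q 0 = s 0 \<and> cost q \<le> D"
proof -
  obtain B where B: "0 \<le> B" "\<forall>q\<in>H. \<bar>A q\<bar> \<le> B" using bounded_potential by blast
  obtain N where N: "\<forall>s\<in>X. \<forall>t\<in>X. \<exists>w\<in>X. \<exists>k\<in>{1..N}. w 0 = s 0 \<and> w k = t 0"
    using uniform_transition_point by blast
  define E where "E = \<bar>\<beta>\<bar> + B"
  have E: "0 \<le> E" using B by (simp add: E_def)
  have len: "cost q \<le> length q * E" if "set q \<subseteq> H" for q
    using that
  proof (induction q)
    case (Cons a q)
    then have "\<beta> - A a \<le> E" using bspec[OF B(2), of a] by (simp add: E_def)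
    with Cons show ?case by (simp add: algebra_simps)
  qed simp
  show ?thesis
  proof (intro exI[of _ "N * E"] conjI ballI)
    show "0 \<le> N * E" using E by simp
    fix s e assume s: "s \<in> X" "e \<in> X"
    then obtain w k where w: "w \<in> X" "k \<in> {1..N}" "w 0 = s 0" "w k = e 0" using N by metis
    then obtain q where q: "chain H e q" "length q = k" "endpoint e q 0 = w 0"
      using chain_to_symbol[OF w(1) s(2) w(4)] by auto
    have "cost q \<le> length q * E" using len chain_set q by blast
    also have "\<dots> \<le> N * E" using q w E by (intro mult_right_mono) auto
    finally show "\<exists>q. chain H e q \<and> q \<noteq> [] \<and> endpoint e q 0 = s 0 \<and> cost q \<le> N * E"
      using q w by auto
  qed
qed

section \<open>Closed chains carry holonomic probabilities\<close>

lemma borel_measurable_hat: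
  assumes "continuous_map (hat_topology r M lam) euclideanreal f"
  shows "f \<in> borel_measurable (sigma H {U. openin (hat_topology r M lam) U})"
proof (rule borel_measurableI)
  interpret Metric_space H "hat_dist lam" by (rule Metric_space_hat_dist[OF lam_pos lam_less_1])
  fix S :: "real set" assume "open S"
  then have "openin mtopology (f -` S \<inter> H)"
    using assms openin_continuous_map_preimage[of mtopology euclideanreal f S]
    by (simp add: vimage_def Int_def conj_commute)
  moreover have "{U. openin mtopology U} \<subseteq> Pow H" using openin_subset[of mtopology] by auto
  ultimately show "f -` S \<inter> space (sigma H {U. openin mtopology U}) \<in> sets (sigma H {U. openin mtopology U})"
    by (simp add: space_measure_of_conv sigma_sets.Basic)
qed

lemma hat_holder: "holder_on \<theta> H (hat_dist lam) A"
  unfolding holder_on_def by (intro exI[of _ C] ballI holder)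

lemma bdd_above_holonomic: "bdd_above ((\<lambda>\<mu>. \<integral>p. A p \<partial>\<mu>) ` holonomic r M lam)"
proof -
  obtain B where B: "0 \<le> B" "\<forall>q\<in>H. \<bar>A q\<bar> \<le> B" using bounded_potential by blast
  have "(\<integral>p. A p \<partial>\<mu>) \<le> B" if mu: "\<mu> \<in> holonomic r M lam" for \<mu>
  proof -
    interpret prob_space \<mu> using mu by (simp add: holonomic_def)
    have "sets \<mu> = sets (sigma H {U. openin (hat_topology r M lam) U})"
      using mu by (simp add: holonomic_def)
    from sets_eq_imp_space_eq[OF this] have "space \<mu> = H" by (simp add: space_measure_of_conv)
    then have "AE p in \<mu>. A p \<le> B" using B(2) by (intro AE_I2) (simp add: abs_le_iff)
    then show ?thesis
      using B(1) by (cases "integrable \<mu> A") (simp_all add: integral_le_const not_integrable_integral_eq)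
  qed
  then show ?thesis by (rule bdd_aboveI2)
qed

text \<open>
  The uniform probability on the steps of a closed chain is holonomic, so the average of \<open>A\<close> along
  the chain is one of the integrals whose supremum is \<open>\<beta>\<close>.
\<close>

lemma closed_chain_cost_nonneg:
  assumes "chain H z p" "p \<noteq> []" "endpoint z p = z"
  shows "0 \<le> cost p"
proof -
  let ?S = "sigma H {U. openin (hat_topology r M lam) U}"
  define n where "n = length p"
  have n: "0 < n" using assms by (simp add: n_def)
  define P where "P = pmf_of_set {..<n}"
  define \<mu> where "\<mu> = distr (measure_pmf P) ?S (\<lambda>j. if j < n then p ! j else hd p)"
  \<comment> \<open>the value outside the range of indices only has to be an element of the path\<close>
  let ?g = "\<lambda>j. if j < n then p ! j else hd p"
  have meas: "?g \<in> measurable (measure_pmf P) ?S"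
    using chain_set[OF assms(1)] assms(2) by (auto simp: n_def space_measure_of_conv)
  have int: "(\<integral>q. f q \<partial>\<mu>) = (\<Sum>q\<leftarrow>p. f q) / n"
    if "continuous_map (hat_topology r M lam) euclideanreal f" for f :: "seq \<times> seq \<Rightarrow> real"
  proof -
    have "(\<integral>q. f q \<partial>\<mu>) = (\<integral>j. f (?g j) \<partial>measure_pmf P)"
      unfolding \<mu>_def by (rule integral_distr[OF meas borel_measurable_hat[OF that]])
    also have "\<dots> = (\<Sum>j<n. f (?g j)) / n"
      unfolding P_def using n by (subst integral_pmf_of_set) auto
    also have "(\<Sum>j<n. f (?g j)) = (\<Sum>q\<leftarrow>p. f q)"
      by (simp add: sum_list_sum_nth n_def atLeast0LessThan)
    finally show ?thesis .
  qed
  have MX: "Metric_space X d" and MH: "Metric_space H (hat_dist lam)"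
    by (auto intro: Metric_space_seq_dist Metric_space_hat_dist lam_pos lam_less_1)
  have "\<mu> \<in> holonomic r M lam"
    unfolding holonomic_def
  proof (intro CollectI conjI allI impI)
    show "prob_space \<mu>" unfolding \<mu>_def by (rule measure_pmf.prob_space_distr[OF meas])
    fix f assume f: "continuous_map (sft_topology r M lam) euclideanreal f"
    have "continuous_map (hat_topology r M lam) (sft_topology r M lam) prepend"
      using nonexpansive_continuous_map[OF MH MX] prepend_in_sft
        prepend_nonexpansive[OF lam_pos lam_less_1] by blast
    moreover have "continuous_map (hat_topology r M lam) (sft_topology r M lam) snd"
      by (rule nonexpansive_continuous_map[OF MH MX]) (auto simp: hat_sft_def snd_nonexpansive)
    ultimately have "continuous_map (hat_topology r M lam) euclideanreal (f \<circ> prepend)"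
        "continuous_map (hat_topology r M lam) euclideanreal (f \<circ> snd)"
      using f continuous_map_compose by blast+
    from int[OF this(1)] int[OF this(2)] chain_telescope[OF assms(1), of f] assms(3)
    have "(\<integral>q. f (prepend q) \<partial>\<mu>) = (\<integral>q. f (snd q) \<partial>\<mu>)" by (simp add: o_def)
    then show "(\<integral>(y, x). f (prepend (y, x)) \<partial>\<mu>) = (\<integral>(y, x). f x \<partial>\<mu>)"
      by (simp add: case_prod_unfold)
  qed (simp add: \<mu>_def)
  then have "(\<integral>q. A q \<partial>\<mu>) \<le> \<beta>"
    unfolding beta_def by (intro cSUP_upper bdd_above_holonomic)
  then have "(\<Sum>q\<leftarrow>p. A q) / n \<le> \<beta>"
    using int[OF holder_continuous_map[OF MH hat_holder theta_pos]] by simp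
  then have "(\<Sum>q\<leftarrow>p. A q) \<le> n * \<beta>" using n by (simp add: field_simps)
  moreover have "cost p = n * \<beta> - (\<Sum>q\<leftarrow>p. A q)"
    by (simp add: cost_def n_def sum_list_subtractf sum_list_triv)
  ultimately show ?thesis by simp
qed

text \<open>
  Closing lemma: a chain, prolonged at bounded cost so that its endpoint \<open>e\<close> has the first symbol of
  \<open>z\<close>, is replayed from the periodic sequence whose period is the word prepended by the chain.
  The replay ends where it started, so its cost is nonnegative.
\<close>

lemma cost_bounded_below:
  "\<exists>K. \<forall>z\<in>X. \<forall>p. chain H z p \<longrightarrow> - K \<le> cost p"
proof -
  from bounded_cost_connection obtain D where D: "0 \<le> D \<and> (\<forall>s\<in>X. \<forall>e\<in>X.
    \<exists>q. chain H e q \<and> q \<noteq> [] \<and> endpoint e q 0 = s 0 \<and> cost q \<le> D)" ..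
  have "- (K\<^sub>1 + D) \<le> cost p" if z: "z \<in> X" and p: "chain H z p" for z p
  proof -
    obtain q where q: "chain H (endpoint z p) q" "q \<noteq> []" "endpoint (endpoint z p) q 0 = z 0" "cost q \<le> D"
      using bspec[OF bspec[OF conjunct2[OF D] z] endpoint_in_sft[OF p z]] by blast
    define p' where "p' = p @ q"
    define n where "n = length p'"
    define e where "e = endpoint z p'"
    have p': "chain H z p'" and n: "0 < n" and e0: "e 0 = z 0"
      using p q by (auto simp: p'_def n_def e_def chain_append endpoint_append)
    have e: "e \<in> X" unfolding e_def by (rule endpoint_in_sft[OF p' z])
    have en: "e n = z 0" using endpoint_tail[OF p', of 0] by (simp add: e_def n_def)
    define \<pi> where "\<pi> = (\<lambda>i. e (i mod n))"
    have "\<pi> \<in> X"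
    proof -
      have "M (e (i mod n)) (e (Suc i mod n)) = 1" for i
      \<comment> \<open>at the end of a period, the next symbol of \<open>e\<close> is that of \<open>z\<close>, which is also the first one of \<open>e\<close>\<close>
      proof (cases "Suc (i mod n) = n")
        case True
        then have "Suc i mod n = 0" by (simp add: mod_Suc)
        moreover have "M (e (i mod n)) (e (Suc (i mod n))) = 1" using e by (auto simp: sft_def)
        ultimately show ?thesis using True en e0 by simp
      next
        case False
        then have "Suc i mod n = Suc (i mod n)" by (simp add: mod_Suc)
        then show ?thesis using e by (auto simp: sft_def)
      qed
      moreover have "\<pi> i \<in> {1..r}" for i using e by (auto simp: \<pi>_def sft_def)
      ultimately show ?thesis by (simp add: sft_def \<pi>_def)
    qed
    moreover have \<pi>0: "\<pi> 0 = z 0" by (simp add: \<pi>_def e0)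
    ultimately have ch: "chain H \<pi> (rebase \<pi> p')" by (rule chain_rebase[OF p'])
    have "endpoint \<pi> (rebase \<pi> p') i = \<pi> i" for i
    proof (cases "i < n")
      case True
      then show ?thesis using endpoint_rebase_head[OF p'] by (simp add: \<pi>_def e_def n_def)
    next
      case False
      then have "endpoint \<pi> (rebase \<pi> p') ((i - n) + length (rebase \<pi> p')) = \<pi> (i - n)"
        by (intro endpoint_tail[OF ch])
      with False show ?thesis by (simp add: n_def[symmetric] \<pi>_def le_mod_geq)
    qed
    then have "endpoint \<pi> (rebase \<pi> p') = \<pi>" by auto
    then have "0 \<le> cost (rebase \<pi> p')" using closed_chain_cost_nonneg[OF ch] n by (auto simp: n_def)
    moreover have "\<bar>cost (rebase \<pi> p') - cost p'\<bar> \<le> K\<^sub>1 * d \<pi> z powr \<theta>"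
      by (rule cost_rebase[OF p' \<open>\<pi> \<in> X\<close> \<pi>0])
    moreover have "K\<^sub>1 * d \<pi> z powr \<theta> \<le> K\<^sub>1"
      using K1_nonneg theta_pos seq_dist_le_1[OF lam_pos lam_less_1]
      by (intro mult_left_le powr_le1) auto
    moreover have "cost p' = cost p + cost q" by (simp add: p'_def)
    ultimately show ?thesis using q(4) by linarith
  qed
  then show ?thesis by blast
qed


section \<open>Loops at a non-wandering point\<close>

text \<open>
  Iterating a loop sums the replay errors \<open>K\<^sub>1 * d w x powr \<theta>\<close> over starting points \<open>w\<close>
  that approach \<open>x\<close>, which is a second geometric series of ratio \<open>\<kappa>\<close>.
\<close>

definition K\<^sub>2 :: real where "K\<^sub>2 = K\<^sub>1 / (1 - \<kappa>)"

lemma K2_nonneg: "0 \<le> K\<^sub>2"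
  using kappa K1_nonneg by (simp add: K\<^sub>2_def)

lemma K2_eq: "K\<^sub>1 + K\<^sub>2 * \<kappa> = K\<^sub>2"
  using kappa by (simp add: K\<^sub>2_def field_simps)

lemma max_powr_le:
  assumes "0 \<le> a" "0 \<le> b" "t \<le> max a b" "0 \<le> t"
  shows "t powr \<theta> \<le> a powr \<theta> + b powr \<theta>"
proof (cases "t \<le> a")
  case True
  then show ?thesis using powr_mono2[OF _ assms(4) True, of \<theta>] theta_pos by (simp add: add_increasing2)
next
  case False
  then have "t \<le> b" using assms by auto
  then show ?thesis using powr_mono2[OF _ assms(4), of \<theta> b] theta_pos by (simp add: add_increasing)
qed

text \<open>
  One replay of \<open>q\<close> from \<open>w\<close> reaches a point within \<open>max (lam * d w x) \<delta>\<close> of \<open>x\<close>, at a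
  cost of at most \<open>\<delta> + K\<^sub>1 * d w x powr \<theta>\<close>.  Induction puts this replay in front of
  \<open>N\<close> others.  A single replay would not do: it ends close to \<open>x\<close> only if \<open>q\<close> is long, and
  a cheap loop may be short.
\<close>

lemma iterated_loop:
  assumes q: "chain H x q" "q \<noteq> []" "d (endpoint x q) x < \<delta>" "cost q \<le> \<delta>" "\<delta> \<le> 1"
    and w: "w \<in> X" "w 0 = x 0"
  shows "\<exists>p. chain H w p \<and> N \<le> length p \<and> d (endpoint w p) x \<le> max (lam ^ N * d w x) \<delta> \<and>
    cost p \<le> K\<^sub>2 * d w x powr \<theta> + N * (\<delta> + K\<^sub>2 * \<delta> powr \<theta>)"
  using w
proof (induction N arbitrary: w)
  case 0
  then show ?case using K2_nonneg by (intro exI[of _ "[]"]) auto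
next
  case (Suc N)
  define p1 where "p1 = rebase w q"
  define w1 where "w1 = endpoint w p1"
  have delta: "0 < \<delta>" using q(3) d_nonneg[of "endpoint x q" x] by linarith
  have ch1: "chain H w p1" unfolding p1_def by (rule chain_rebase[OF q(1) Suc.prems])
  have w1: "w1 \<in> X" unfolding w1_def by (rule endpoint_in_sft[OF ch1 Suc.prems(1)])
  have "d w1 (endpoint x q) = lam ^ length q * d w x"
    unfolding w1_def p1_def by (rule seq_dist_endpoint_rebase[OF q(1)])
  also have "\<dots> \<le> lam ^ 1 * d w x"
    using q(2) lam_pos lam_less_1
    by (intro mult_right_mono power_decreasing) (auto simp: Suc_le_eq)
  finally have le: "d w1 (endpoint x q) \<le> lam * d w x" by simp
  have dist: "d w1 x \<le> max (d w1 (endpoint x q)) (d (endpoint x q) x)"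
    by (rule seq_dist_ultra[OF lam_pos lam_less_1])
  with le q(3) have dist1: "d w1 x \<le> max (lam * d w x) \<delta>" by linarith
  have "lam * d w x \<le> lam"
    using lam_pos seq_dist_le_1[OF lam_pos lam_less_1] by (simp add: mult_left_le)
  with le dist q(3,5) lam_less_1 have "d w1 x < 1" by linarith
  then have w10: "w1 0 = x 0" using seq_dist_less_1_iff[OF lam_pos lam_less_1] by blast
  from Suc.IH[OF w1 w10] obtain p where p: "chain H w1 p" "N \<le> length p"
    "d (endpoint w1 p) x \<le> max (lam ^ N * d w1 x) \<delta>"
    "cost p \<le> K\<^sub>2 * d w1 x powr \<theta> + N * (\<delta> + K\<^sub>2 * \<delta> powr \<theta>)" by (elim exE conjE)
  have c1: "\<bar>cost p1 - cost q\<bar> \<le> K\<^sub>1 * d w x powr \<theta>"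
    unfolding p1_def by (rule cost_rebase[OF q(1) Suc.prems])
  have "d w1 x powr \<theta> \<le> (lam * d w x) powr \<theta> + \<delta> powr \<theta>"
    using lam_pos delta dist1 by (intro max_powr_le) auto
  also have "(lam * d w x) powr \<theta> = \<kappa> * d w x powr \<theta>"
    using lam_pos by (simp add: powr_mult \<kappa>_def)
  finally have "K\<^sub>2 * d w1 x powr \<theta> \<le> K\<^sub>2 * (\<kappa> * d w x powr \<theta> + \<delta> powr \<theta>)"
    by (rule mult_left_mono[OF _ K2_nonneg])
  with c1 p(4) q(4) have "cost p1 + cost p
      \<le> (K\<^sub>1 + K\<^sub>2 * \<kappa>) * d w x powr \<theta> + Suc N * (\<delta> + K\<^sub>2 * \<delta> powr \<theta>)"
    by (simp add: algebra_simps)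
  moreover have "lam ^ N * d w1 x \<le> max (lam ^ Suc N * d w x) \<delta>"
  proof -
    have "lam ^ N * d w1 x \<le> lam ^ N * max (lam * d w x) \<delta>"
      using dist1 lam_pos by (intro mult_left_mono) auto
    also have "\<dots> = max (lam ^ Suc N * d w x) (lam ^ N * \<delta>)"
      using lam_pos by (simp add: max_mult_distrib_left mult_ac)
    also have "lam ^ N * \<delta> \<le> \<delta>"
      using lam_pos lam_less_1 delta by (simp add: mult_left_le_one_le power_le_one)
    finally show ?thesis by (simp add: max.coboundedI1 max.coboundedI2 max.mono)
  qed
  moreover have "1 \<le> length p1" using q(2) by (simp add: p1_def Suc_le_eq)
  ultimately show ?case
    using ch1 p unfolding K2_eq
    by (intro exI[of _ "p1 @ p"]) (auto simp: chain_append endpoint_append w1_def)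
qed

lemma small_error:
  assumes "0 < \<epsilon>" "0 < \<eta>"
  shows "\<exists>\<delta>. 0 < \<delta> \<and> \<delta> < \<epsilon> \<and> \<delta> < 1 \<and> real N * (\<delta> + K\<^sub>2 * \<delta> powr \<theta>) < \<eta>"
proof -
  have "((\<lambda>\<delta>. \<delta> powr \<theta>) \<longlongrightarrow> 0) (at_right 0)"
    using theta_pos by real_asymp
  then have "((\<lambda>\<delta>. real N * (\<delta> + K\<^sub>2 * \<delta> powr \<theta>)) \<longlongrightarrow> real N * (0 + K\<^sub>2 * 0)) (at_right 0)"
    by (intro tendsto_intros)
  then have "\<forall>\<^sub>F \<delta> in at_right 0. real N * (\<delta> + K\<^sub>2 * \<delta> powr \<theta>) < \<eta>"
    using assms(2) by (intro order_tendstoD(2)[where y = "real N * (0 + K\<^sub>2 * 0)"]) auto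
  moreover have "\<forall>\<^sub>F \<delta> in at_right (0::real). 0 < \<delta> \<and> \<delta> < min \<epsilon> 1"
    using assms(1) by (intro eventually_at_rightI[of 0 "min \<epsilon> 1"]) auto
  ultimately have "\<forall>\<^sub>F \<delta> in at_right 0.
      0 < \<delta> \<and> \<delta> < \<epsilon> \<and> \<delta> < 1 \<and> real N * (\<delta> + K\<^sub>2 * \<delta> powr \<theta>) < \<eta>"
    by eventually_elim auto
  then show ?thesis using eventually_happens'[OF trivial_limit_at_right_real] by fast
qed

lemma small_powr_error:
  assumes "0 < \<eta>"
  shows "\<exists>\<epsilon>. 0 < \<epsilon> \<and> \<epsilon> < 1 \<and> K\<^sub>2 * \<epsilon> powr \<theta> < \<eta>"
  using small_error[of 1 \<eta> 1] assms by fastforce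

text \<open>
  The number \<open>N\<close> of iterations is chosen first, so that \<open>lam ^ N < \<epsilon>\<close>; only then is the loop
  taken so precise that \<open>N\<close> times its defect is below \<open>\<eta>\<close>.
\<close>

lemma cheap_return:
  assumes x: "x \<in> nonwandering r M lam A" and w: "w \<in> X" "w 0 = x 0" and "0 < \<epsilon>" "0 < \<eta>"
  shows "\<exists>p. chain H w p \<and> p \<noteq> [] \<and> d (endpoint w p) x < \<epsilon> \<and>
    cost p \<le> K\<^sub>2 * d w x powr \<theta> + \<eta>"
proof -
  obtain n where n: "lam ^ n < \<epsilon>" using real_arch_pow_inv[OF assms(4) lam_less_1] by auto
  \<comment> \<open>the successor forces at least one iteration, so that the path is not empty\<close>
  define N where "N = Suc n"
  have N: "lam ^ N < \<epsilon>"
    using n lam_pos lam_less_1 by (simp add: N_def) (smt (verit) mult_left_le_one_le zero_less_power)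
  obtain \<delta> where \<delta>: "0 < \<delta>" "\<delta> < \<epsilon>" "\<delta> < 1" "real N * (\<delta> + K\<^sub>2 * \<delta> powr \<theta>) < \<eta>"
    using small_error[OF assms(4,5)] by blast
  obtain q where "q \<in> paths r M lam x x \<delta>" "\<bar>path_sum r M lam A q\<bar> < \<delta>"
    using x \<delta>(1) unfolding nonwandering_def by blast
  then have q: "chain H x q" "q \<noteq> []" "d (endpoint x q) x < \<delta>" "cost q \<le> \<delta>"
    by (auto simp: paths_chain path_sum_eq_cost)
  from iterated_loop[OF q less_imp_le[OF \<delta>(3)] w, of N] obtain p where
    p: "chain H w p" "N \<le> length p" "d (endpoint w p) x \<le> max (lam ^ N * d w x) \<delta>"
      "cost p \<le> K\<^sub>2 * d w x powr \<theta> + N * (\<delta> + K\<^sub>2 * \<delta> powr \<theta>)" by (elim exE conjE)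
  have "lam ^ N * d w x \<le> lam ^ N"
    using lam_pos seq_dist_le_1[OF lam_pos lam_less_1] by (simp add: mult_left_le)
  with p(3) N \<delta>(2) have "d (endpoint w p) x < \<epsilon>" by linarith
  moreover have "p \<noteq> []" using p(2) by (auto simp: N_def)
  ultimately show ?thesis using p(1,4) \<delta>(4) by (intro exI[of _ p]) linarith
qed

section \<open>The Mane potential is finite\<close>

text \<open>
  The least cost that suffices at every precision.  This real-valued form of the Mane potential avoids
  arithmetic in the extended reals; the two agree by \<open>mane_eq_mane_real\<close>.
\<close>

definition mane_real :: "seq \<Rightarrow> seq \<Rightarrow> real" where
  "mane_real x z = Inf {c. \<forall>\<epsilon>>0. \<exists>p\<in>paths r M lam x z \<epsilon>. cost p \<le> c}"

text \<open>
  Some cost suffices at every precision: connect \<open>z\<close> to a point with the first symbol of \<open>x\<close>,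
  then return cheaply.  The infimum is therefore over a nonempty set.
\<close>

lemma mane_real_greater:
  assumes x: "x \<in> nonwandering r M lam A" and z: "z \<in> X" and "0 < \<epsilon>" "0 < \<eta>"
  shows "\<exists>p\<in>paths r M lam x z \<epsilon>. cost p < mane_real x z + \<eta>"
proof -
  define T where "T = {c. \<forall>\<epsilon>>0. \<exists>p\<in>paths r M lam x z \<epsilon>. cost p \<le> c}"
  have xX: "x \<in> X" using x by (simp add: nonwandering_def)
  obtain D where D: "0 \<le> D \<and> (\<forall>s\<in>X. \<forall>e\<in>X.
      \<exists>q. chain H e q \<and> q \<noteq> [] \<and> endpoint e q 0 = s 0 \<and> cost q \<le> D)"
    using bounded_cost_connection ..
  obtain q where q: "chain H z q" "q \<noteq> []" "endpoint z q 0 = x 0"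
    using bspec[OF bspec[OF conjunct2[OF D] xX] z] by blast
  define w where "w = endpoint z q"
  have w: "w \<in> X" "w 0 = x 0" using endpoint_in_sft[OF q(1) z] q(3) by (auto simp: w_def)
  have "cost q + (K\<^sub>2 * d w x powr \<theta> + 1) \<in> T"
    unfolding T_def
  proof (intro CollectI allI impI)
    fix \<epsilon> :: real assume "0 < \<epsilon>"
    from cheap_return[OF x w this zero_less_one] obtain p where
      p: "chain H w p" "p \<noteq> []" "d (endpoint w p) x < \<epsilon>" "cost p \<le> K\<^sub>2 * d w x powr \<theta> + 1"
      by blast
    then have "q @ p \<in> paths r M lam x z \<epsilon>"
      using q by (simp add: paths_chain chain_append endpoint_append w_def)
    with p(4) show "\<exists>p\<in>paths r M lam x z \<epsilon>. cost p \<le> cost q + (K\<^sub>2 * d w x powr \<theta> + 1)"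
      by (intro bexI) auto
  qed
  then have "T \<noteq> {}" by blast
  then obtain c where "c \<in> T" "c < mane_real x z + \<eta>"
    using cInf_lessD[of T "mane_real x z + \<eta>"] assms(4) by (auto simp: mane_real_def T_def)
  then show ?thesis using assms(3) unfolding T_def by force
qed

text \<open>
  The given chain is followed by cheap returns to \<open>x\<close> of arbitrary precision.  The chain may be
  empty; this matters when a path of length one loses its first step.
\<close>

lemma mane_real_le:
  assumes x: "x \<in> nonwandering r M lam A" and z: "z \<in> X"
    and p: "chain H z p" "d (endpoint z p) x < 1"
  shows "mane_real x z \<le> cost p + K\<^sub>2 * d (endpoint z p) x powr \<theta>"
proof (rule field_le_epsilon)
  fix \<eta> :: real assume eta: "0 < \<eta>"
  define w where "w = endpoint z p"
  have w: "w \<in> X" "w 0 = x 0"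
    using endpoint_in_sft[OF p(1) z] p(2) seq_dist_less_1_iff[OF lam_pos lam_less_1]
    by (auto simp: w_def)
  define T where "T = {c. \<forall>\<epsilon>>0. \<exists>p\<in>paths r M lam x z \<epsilon>. cost p \<le> c}"
  have "cost p + K\<^sub>2 * d w x powr \<theta> + \<eta> \<in> T"
    unfolding T_def
  proof (intro CollectI allI impI)
    fix \<epsilon> :: real assume "0 < \<epsilon>"
    from cheap_return[OF x w this eta] obtain p' where
      p': "chain H w p'" "p' \<noteq> []" "d (endpoint w p') x < \<epsilon>" "cost p' \<le> K\<^sub>2 * d w x powr \<theta> + \<eta>"
      by blast
    then have "p @ p' \<in> paths r M lam x z \<epsilon>"
      using p by (simp add: paths_chain chain_append endpoint_append w_def)
    with p'(4) show "\<exists>q\<in>paths r M lam x z \<epsilon>. cost q \<le> cost p + K\<^sub>2 * d w x powr \<theta> + \<eta>"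
      by (intro bexI) auto
  qed
  moreover have "bdd_below T"
  proof -
    obtain K where K: "\<forall>z\<in>X. \<forall>p. chain H z p \<longrightarrow> - K \<le> cost p" using cost_bounded_below ..
    have "- K \<le> c" if c: "c \<in> T" for c
    proof -
      obtain p where "p \<in> paths r M lam x z 1" "cost p \<le> c"
        using c zero_less_one unfolding T_def by blast
      moreover from this have "- K \<le> cost p" using K z by (simp add: paths_chain)
      ultimately show ?thesis by linarith
    qed
    then show ?thesis by (rule bdd_belowI)
  qed
  ultimately have "Inf T \<le> cost p + K\<^sub>2 * d w x powr \<theta> + \<eta>" by (rule cInf_lower)
  then show "mane_real x z \<le> cost p + K\<^sub>2 * d (endpoint z p) x powr \<theta> + \<eta>"
    by (simp add: mane_real_def T_def w_def)
qed

lemma mane_real_near_optimal: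
  assumes x: "x \<in> nonwandering r M lam A" and z: "z \<in> X" and "0 < \<eta>"
  shows "\<exists>p. chain H z p \<and> p \<noteq> [] \<and> d (endpoint z p) x < 1 \<and>
    K\<^sub>2 * d (endpoint z p) x powr \<theta> < \<eta> \<and> cost p < mane_real x z + \<eta>"
proof -
  obtain \<epsilon> where \<epsilon>: "0 < \<epsilon>" "\<epsilon> < 1" "K\<^sub>2 * \<epsilon> powr \<theta> < \<eta>" using small_powr_error[OF assms(3)] by blast
  obtain p where p: "p \<in> paths r M lam x z \<epsilon>" "cost p < mane_real x z + \<eta>"
    using mane_real_greater[OF x z \<epsilon>(1) assms(3)] by blast
  then have "d (endpoint z p) x < \<epsilon>" by (simp add: paths_chain)
  then have "d (endpoint z p) x powr \<theta> \<le> \<epsilon> powr \<theta>" using theta_pos by (intro powr_mono2) auto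
  then have "K\<^sub>2 * d (endpoint z p) x powr \<theta> \<le> K\<^sub>2 * \<epsilon> powr \<theta>" by (rule mult_left_mono[OF _ K2_nonneg])
  with p \<epsilon> show ?thesis by (intro exI[of _ p]) (auto simp: paths_chain)
qed

text \<open>
  The infimum at precision \<open>\<epsilon> < 1\<close> lies between \<open>mane_real x z - K\<^sub>2 * \<epsilon> powr \<theta>\<close> and
  \<open>mane_real x z\<close>.
\<close>

lemma mane_eq_mane_real:
  assumes x: "x \<in> nonwandering r M lam A" and z: "z \<in> X"
  shows "mane r M lam A x z = ereal (mane_real x z)"
proof -
  let ?u = "mane_real x z"
  have upper: "mane_eps r M lam A \<epsilon> x z \<le> ereal ?u" if eps: "0 < \<epsilon>" for \<epsilon>
  proof (rule ereal_le_epsilon2)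
    fix \<eta> :: real assume "0 < \<eta>"
    then obtain p where p: "p \<in> paths r M lam x z \<epsilon>" "cost p < ?u + \<eta>"
      using mane_real_greater[OF x z eps] by blast
    have "mane_eps r M lam A \<epsilon> x z \<le> ereal (cost p)"
      unfolding mane_eps_def by (rule INF_lower2[OF p(1)]) (simp add: path_sum_eq_cost)
    also have "\<dots> \<le> ereal ?u + ereal \<eta>" using p(2) by simp
    finally show "mane_eps r M lam A \<epsilon> x z \<le> ereal ?u + ereal \<eta>" .
  qed
  have lower: "ereal (?u - K\<^sub>2 * \<epsilon> powr \<theta>) \<le> mane_eps r M lam A \<epsilon> x z" if "0 < \<epsilon>" "\<epsilon> < 1" for \<epsilon>
    unfolding mane_eps_def
  proof (rule INF_greatest)
    fix p assume "p \<in> paths r M lam x z \<epsilon>"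
    then have p: "chain H z p" "d (endpoint z p) x < \<epsilon>" by (auto simp: paths_chain)
    have "d (endpoint z p) x powr \<theta> \<le> \<epsilon> powr \<theta>" using theta_pos p(2) by (intro powr_mono2) auto
    then have "K\<^sub>2 * d (endpoint z p) x powr \<theta> \<le> K\<^sub>2 * \<epsilon> powr \<theta>" by (rule mult_left_mono[OF _ K2_nonneg])
    with mane_real_le[OF x z p(1)] p(2) that(2)
    show "ereal (?u - K\<^sub>2 * \<epsilon> powr \<theta>) \<le> ereal (- path_sum r M lam A p)"
      by (simp add: path_sum_eq_cost)
  qed
  have "((\<lambda>\<epsilon>. \<epsilon> powr \<theta>) \<longlongrightarrow> 0) (at_right 0)"
    using theta_pos by real_asymp
  then have "((\<lambda>\<epsilon>. ?u - K\<^sub>2 * \<epsilon> powr \<theta>) \<longlongrightarrow> ?u - K\<^sub>2 * 0) (at_right 0)"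
    by (intro tendsto_intros)
  then have lim: "((\<lambda>\<epsilon>. ereal (?u - K\<^sub>2 * \<epsilon> powr \<theta>)) \<longlongrightarrow> ereal ?u) (at_right 0)" by simp
  have "((\<lambda>\<epsilon>. mane_eps r M lam A \<epsilon> x z) \<longlongrightarrow> ereal ?u) (at_right 0)"
  proof (rule tendsto_sandwich[OF _ _ lim tendsto_const])
    show "\<forall>\<^sub>F \<epsilon> in at_right 0. ereal (?u - K\<^sub>2 * \<epsilon> powr \<theta>) \<le> mane_eps r M lam A \<epsilon> x z"
      by (rule eventually_at_rightI[of 0 1]) (auto intro: lower)
    show "\<forall>\<^sub>F \<epsilon> in at_right 0. mane_eps r M lam A \<epsilon> x z \<le> ereal ?u"
      by (rule eventually_at_rightI[of 0 1]) (auto intro: upper)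
  qed
  then show ?thesis unfolding mane_def by (intro tendsto_Lim) simp_all
qed

section \<open>Regularity and calibration\<close>

text \<open>
  An almost optimal path from \<open>z\<close>, replayed from \<open>z'\<close>, costs at most \<open>K\<^sub>1 * d z' z powr \<theta>\<close>
  more.  Its distance from \<open>x\<close> at the end is at most \<open>d z' z\<close> up to a small error, and the return
  from there accounts for \<open>K\<^sub>2\<close>.
\<close>

lemma mane_real_local_holder:
  assumes x: "x \<in> nonwandering r M lam A" and z: "z \<in> X" "z' \<in> X" "z' 0 = z 0"
  shows "mane_real x z' \<le> mane_real x z + (K\<^sub>1 + K\<^sub>2) * d z' z powr \<theta>"
proof (rule field_le_epsilon)
  fix \<eta> :: real assume eta: "0 < \<eta>"
  then obtain p where p: "chain H z p" "p \<noteq> []" "d (endpoint z p) x < 1"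
    "K\<^sub>2 * d (endpoint z p) x powr \<theta> < \<eta> / 2" "cost p < mane_real x z + \<eta> / 2"
    using mane_real_near_optimal[OF x z(1), of "\<eta> / 2"] by auto
  define e' where "e' = endpoint z' (rebase z' p)"
  have dz: "d z' z < 1" using z(3) seq_dist_less_1_iff[OF lam_pos lam_less_1] by blast
  have "d e' (endpoint z p) = lam ^ length p * d z' z"
    unfolding e'_def by (rule seq_dist_endpoint_rebase[OF p(1)])
  also have "\<dots> \<le> d z' z"
    using lam_pos lam_less_1 by (simp add: mult_left_le_one_le power_le_one)
  finally have dist: "d e' x \<le> max (d z' z) (d (endpoint z p) x)"
    using seq_dist_ultra[OF lam_pos lam_less_1, of e' x "endpoint z p"] by linarith
  have "d e' x powr \<theta> \<le> d z' z powr \<theta> + d (endpoint z p) x powr \<theta>"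
    by (rule max_powr_le[OF _ _ dist]) auto
  then have "K\<^sub>2 * d e' x powr \<theta> \<le> K\<^sub>2 * (d z' z powr \<theta> + d (endpoint z p) x powr \<theta>)"
    by (rule mult_left_mono[OF _ K2_nonneg])
  moreover have "mane_real x z' \<le> cost (rebase z' p) + K\<^sub>2 * d e' x powr \<theta>"
    unfolding e'_def
    by (rule mane_real_le[OF x z(2) chain_rebase[OF p(1) z(2,3)]])
      (use dist dz p(3) in \<open>auto simp: e'_def\<close>)
  moreover have "\<bar>cost (rebase z' p) - cost p\<bar> \<le> K\<^sub>1 * d z' z powr \<theta>"
    by (rule cost_rebase[OF p(1) z(2,3)])
  ultimately show "mane_real x z' \<le> mane_real x z + (K\<^sub>1 + K\<^sub>2) * d z' z powr \<theta> + \<eta>"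
    using p(4,5) by (simp add: algebra_simps)
qed

lemma mane_real_bounded:
  assumes x: "x \<in> nonwandering r M lam A"
  shows "\<exists>B\<ge>0. \<forall>z\<in>X. \<bar>mane_real x z\<bar> \<le> B"
proof -
  have xX: "x \<in> X" using x by (simp add: nonwandering_def)
  obtain D where D: "0 \<le> D \<and> (\<forall>s\<in>X. \<forall>e\<in>X.
      \<exists>q. chain H e q \<and> q \<noteq> [] \<and> endpoint e q 0 = s 0 \<and> cost q \<le> D)"
    using bounded_cost_connection ..
  obtain K where K: "\<forall>z\<in>X. \<forall>p. chain H z p \<longrightarrow> - K \<le> cost p" using cost_bounded_below ..
  have "\<bar>mane_real x z\<bar> \<le> D + K\<^sub>2 + \<bar>K\<bar> + 1" if z: "z \<in> X" for z
  proof -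
    obtain q where q: "chain H z q" "endpoint z q 0 = x 0" "cost q \<le> D"
      using bspec[OF bspec[OF conjunct2[OF D] xX] z] by blast
    then have dq: "d (endpoint z q) x < 1" using seq_dist_less_1_iff[OF lam_pos lam_less_1] by blast
    have "K\<^sub>2 * d (endpoint z q) x powr \<theta> \<le> K\<^sub>2"
      using K2_nonneg dq theta_pos by (intro mult_left_le powr_le1) auto
    then have "mane_real x z \<le> D + K\<^sub>2" using mane_real_le[OF x z q(1) dq] q(3) by linarith
    moreover obtain p where "chain H z p" "cost p < mane_real x z + 1"
      using mane_real_near_optimal[OF x z zero_less_one] by blast
    moreover from this have "- K \<le> cost p" using K z by blast
    ultimately show ?thesis using D K2_nonneg by linarith
  qed
  then show ?thesis using D K2_nonneg by (intro exI[of _ "D + K\<^sub>2 + \<bar>K\<bar> + 1"]) auto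
qed

text \<open>
  Points with different first symbols are at distance one, so for them boundedness is enough.
\<close>

lemma mane_real_holder:
  assumes x: "x \<in> nonwandering r M lam A"
  shows "holder_on \<theta> X d (mane_real x)"
proof -
  obtain B where B: "0 \<le> B \<and> (\<forall>z\<in>X. \<bar>mane_real x z\<bar> \<le> B)" using mane_real_bounded[OF x] ..
  have "\<bar>mane_real x z - mane_real x z'\<bar> \<le> (K\<^sub>1 + K\<^sub>2 + 2 * B) * d z z' powr \<theta>"
    if z: "z \<in> X" "z' \<in> X" for z z'
  proof (cases "z 0 = z' 0")
    case True
    have "\<bar>mane_real x z - mane_real x z'\<bar> \<le> (K\<^sub>1 + K\<^sub>2) * d z z' powr \<theta>"
      using mane_real_local_holder[OF x z(1,2)] mane_real_local_holder[OF x z(2,1)] True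
      by (auto simp: seq_dist_commute[of lam z'])
    also have "\<dots> \<le> (K\<^sub>1 + K\<^sub>2 + 2 * B) * d z z' powr \<theta>"
      using B by (intro mult_right_mono) auto
    finally show ?thesis .
  next
    case False
    then have "d z z' = 1"
      using seq_dist_less_1_iff[OF lam_pos lam_less_1] seq_dist_le_1[OF lam_pos lam_less_1]
      by (metis less_eq_real_def)
    moreover have "\<bar>mane_real x z\<bar> \<le> B" "\<bar>mane_real x z'\<bar> \<le> B" using B z by blast+
    ultimately show ?thesis using K1_nonneg K2_nonneg by simp
  qed
  then show ?thesis unfolding holder_on_def by blast
qed

lemma mane_real_subaction:
  assumes x: "x \<in> nonwandering r M lam A" and q: "(y, z) \<in> H"
  shows "mane_real x z \<le> mane_real x (prepend (y, z)) - A (y, z) + \<beta>"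
proof (rule field_le_epsilon)
  fix \<eta> :: real assume eta: "0 < \<eta>"
  have z: "z \<in> X" using q by (simp add: hat_sft_def)
  obtain p where p: "chain H (prepend (y, z)) p" "d (endpoint (prepend (y, z)) p) x < 1"
    "K\<^sub>2 * d (endpoint (prepend (y, z)) p) x powr \<theta> < \<eta> / 2"
    "cost p < mane_real x (prepend (y, z)) + \<eta> / 2"
    using mane_real_near_optimal[OF x prepend_in_sft[OF q], of "\<eta> / 2"] eta by auto
  have "mane_real x z \<le> cost ((y, z) # p) + K\<^sub>2 * d (endpoint z ((y, z) # p)) x powr \<theta>"
    using p q by (intro mane_real_le[OF x z]) auto
  then show "mane_real x z \<le> mane_real x (prepend (y, z)) - A (y, z) + \<beta> + \<eta>"
    using p(3,4) by simp
qed

text \<open>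
  The first step of an almost optimal path is an almost optimal choice in the fibre.
\<close>

lemma mane_real_almost_calibrated:
  assumes x: "x \<in> nonwandering r M lam A" and z: "z \<in> X" and "0 < \<eta>"
  shows "\<exists>y\<in>dual_fibre r M z. mane_real x (prepend (y, z)) - A (y, z) + \<beta> \<le> mane_real x z + \<eta>"
proof -
  obtain p where p: "chain H z p" "p \<noteq> []" "d (endpoint z p) x < 1"
    "K\<^sub>2 * d (endpoint z p) x powr \<theta> < \<eta> / 2" "cost p < mane_real x z + \<eta> / 2"
    using mane_real_near_optimal[OF x z, of "\<eta> / 2"] assms(3) by auto
  obtain y p' where pp: "p = (y, z) # p'"
    using p(1,2) by (cases p) auto
  have q: "(y, z) \<in> H" and p': "chain H (prepend (y, z)) p'" using p(1) pp by auto
  have "mane_real x (prepend (y, z)) \<le>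
      cost p' + K\<^sub>2 * d (endpoint (prepend (y, z)) p') x powr \<theta>"
    using p(3) pp by (intro mane_real_le[OF x prepend_in_sft[OF q] p']) simp
  moreover have "y \<in> dual_fibre r M z" using q by (auto simp: dual_fibre_def hat_sft_def)
  ultimately show ?thesis using p(4,5) pp by (intro bexI[of _ y]) auto
qed

lemma mane_real_calibrated:
  assumes x: "x \<in> nonwandering r M lam A"
  shows "calibrated_subaction r M lam A (mane_real x)"
  unfolding calibrated_subaction_def
proof (intro conjI ballI)
  show "continuous_map (sft_topology r M lam) euclideanreal (mane_real x)"
    by (rule holder_continuous_map[OF Metric_space_seq_dist[OF lam_pos lam_less_1]
          mane_real_holder[OF x] theta_pos])
  fix z assume z: "z \<in> X"
  show sub: "mane_real x z \<le> mane_real x (prepend (y, z)) - A (y, z) + \<beta>"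
    if "y \<in> dual_fibre r M z" for y
    using that by (intro mane_real_subaction[OF x]) (simp add: dual_fibre_def)
  define F where "F = dual_fibre r M z"
  define g where "g = (\<lambda>y. mane_real x (prepend (y, z)) - A (y, z) + \<beta>)"
  have "continuous_on F g"
  proof (rule continuous_on_cylinders)
    fix y e assume y: "y \<in> F" and e: "(0::real) < e"
    obtain n where n: "\<kappa> ^ n < e / (C + 1)"
      using real_arch_pow_inv[of "e / (C + 1)" \<kappa>] e C_nonneg kappa by auto
    have "\<bar>g y' - g y\<bar> < e" if y': "y' \<in> F" "\<forall>i<Suc n. y' i = y i" for y'
    proof -
      have "d y' y \<le> lam ^ n" by (rule seq_dist_agree[OF lam_pos lam_less_1]) (use y'(2) in auto)
      then have "d y' y powr \<theta> \<le> (lam ^ n) powr \<theta>" using theta_pos by (intro powr_mono2) auto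
      also have "(lam ^ n) powr \<theta> = \<kappa> ^ n"
        using lam_pos by (simp add: \<kappa>_def powr_realpow[symmetric] powr_powr mult.commute)
      finally have "C * d y' y powr \<theta> \<le> C * \<kappa> ^ n" by (rule mult_left_mono[OF _ C_nonneg])
      also have "\<dots> \<le> (C + 1) * \<kappa> ^ n" using kappa by (intro mult_right_mono) auto
      also have "\<dots> < e" using n C_nonneg by (simp add: pos_less_divide_eq mult.commute)
      finally have "C * d y' y powr \<theta> < e" .
      moreover have "prepend (y', z) = prepend (y, z)" using y'(2) by (simp add: prepend_def)
      moreover have "\<bar>A (y', z) - A (y, z)\<bar> \<le> C * hat_dist lam (y', z) (y, z) powr \<theta>"
        using y y' by (intro holder) (auto simp: F_def dual_fibre_def)
      moreover have "hat_dist lam (y', z) (y, z) = d y' y"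
        by (simp add: hat_dist_def seq_dist_eq_0[OF lam_pos, THEN iffD2] max_absorb1)
      ultimately show ?thesis by (simp add: g_def abs_minus_commute)
    qed
    then show "\<exists>n. \<forall>y'\<in>F. (\<forall>i<n. y' i = y i) \<longrightarrow> \<bar>g y' - g y\<bar> < e" by blast
  qed
  moreover have "F \<noteq> {}" using mane_real_almost_calibrated[OF x z zero_less_one] by (auto simp: F_def)
  ultimately obtain y where y: "y \<in> F" "\<forall>y'\<in>F. g y \<le> g y'"
    using continuous_attains_inf[of F g] compact_dual_fibre by (auto simp: F_def)
  have "g y \<le> mane_real x z"
  proof (rule field_le_epsilon)
    fix \<eta> :: real assume "0 < \<eta>"
    then obtain y' where "y' \<in> F" "g y' \<le> mane_real x z + \<eta>"
      using mane_real_almost_calibrated[OF x z] by (auto simp: F_def g_def)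
    with y show "g y \<le> mane_real x z + \<eta>" by force
  qed
  with sub[of y] y(1) show "\<exists>y\<in>dual_fibre r M z.
      mane_real x z = mane_real x (prepend (y, z)) - A (y, z) + \<beta>"
    by (intro bexI[of _ y]) (auto simp: F_def g_def)
qed

end

lemma calibrated_subaction_cong:
  assumes "0 < lam" "lam < 1" "\<And>z. z \<in> sft r M \<Longrightarrow> u z = v z" "calibrated_subaction r M lam A v"
  shows "calibrated_subaction r M lam A u"
proof -
  interpret Metric_space "sft r M" "seq_dist lam" by (rule Metric_space_seq_dist[OF assms(1,2)])
  have "prepend (y, z) \<in> sft r M" if "y \<in> dual_fibre r M z" for y z
    using that by (intro prepend_in_sft) (simp add: dual_fibre_def)
  moreover have "continuous_map mtopology euclideanreal u"
    by (rule continuous_map_eq[of _ _ v]) (use assms(3,4) in \<open>auto simp: calibrated_subaction_def\<close>)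
  ultimately show ?thesis using assms(3,4) by (simp add: calibrated_subaction_def)
qed

theorem proposition8:
  fixes r :: nat and M :: "nat \<Rightarrow> nat \<Rightarrow> nat" and lam \<theta> :: real
    and A :: "seq \<times> seq \<Rightarrow> real" and x :: seq
  assumes "zero_one_matrix r M" and "sft r M \<noteq> {}"
    and "0 < lam" and "lam < 1" and "0 < \<theta>"
    and "transitive_sft r M lam"
    and "holder_on \<theta> (hat_sft r M) (hat_dist lam) A"
    and "x \<in> nonwandering r M lam A"
  shows "(\<forall>z\<in>sft r M. \<bar>mane r M lam A x z\<bar> \<noteq> \<infinity>) \<and>
         holder_on \<theta> (sft r M) (seq_dist lam) (\<lambda>z. real_of_ereal (mane r M lam A x z)) \<and>
         calibrated_subaction r M lam A (\<lambda>z. real_of_ereal (mane r M lam A x z))"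
proof -
  obtain C where C: "\<forall>p\<in>hat_sft r M. \<forall>q\<in>hat_sft r M. \<bar>A p - A q\<bar> \<le> C * hat_dist lam p q powr \<theta>"
    using assms(7) unfolding holder_on_def ..
  interpret sft_potential r M lam \<theta> "\<bar>C\<bar>" A
  proof
    fix p q assume "p \<in> hat_sft r M" "q \<in> hat_sft r M"
    then have "\<bar>A p - A q\<bar> \<le> C * hat_dist lam p q powr \<theta>" using C by blast
    also have "\<dots> \<le> \<bar>C\<bar> * hat_dist lam p q powr \<theta>" by (intro mult_right_mono) auto
    finally show "\<bar>A p - A q\<bar> \<le> \<bar>C\<bar> * hat_dist lam p q powr \<theta>" .
  qed (use assms in auto)
  have eq: "mane r M lam A x z = ereal (mane_real x z)" if "z \<in> sft r M" for z
    by (rule mane_eq_mane_real[OF assms(8) that])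
  have "holder_on \<theta> (sft r M) (seq_dist lam) (\<lambda>z. real_of_ereal (mane r M lam A x z))"
    using mane_real_holder[OF assms(8)] by (simp add: holder_on_def eq)
  moreover have "calibrated_subaction r M lam A (\<lambda>z. real_of_ereal (mane r M lam A x z))"
    by (rule calibrated_subaction_cong[OF assms(3,4) _ mane_real_calibrated[OF assms(8)]]) (simp add: eq)
  ultimately show ?thesis by (simp add: eq)
qed

end
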